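(* Let $\mathcal I=[a,b]\subset\mathbb R^+$, $M=\mathcal I\times S^1$ with the measure $dI\,d\theta$, and consider the system $\dot I=0$, $\dot\theta=I$ on $M$, with Koopman operator $U^tf(I,\theta)=f(I,\theta+It)$ on $L^2(M)$. For $f\in L^2(M)$ with Fourier series $f(I,\theta)=\sum_{j\in\mathbb Z}a_j(I)e^{ij\theta}$, let $f^*(I)=a_0(I)$ and, with $\mathbb Z'=\mathbb Z\setminus\{0\}$, define for Borel sets $E\subset\mathbb R$ $$P(E)f=\int_E dP_\beta(f),\qquad dP_\beta(f(I,\theta))=\sum_{j\in\mathbb Z'}a_j(I)e^{ij\theta}\,\delta(jI-\beta)\,d\beta .$$ Then $P$ is a projection-valued measure on $\mathbb R$ acting on the space of square integrable functions of zero mean (those with $f^*=0$), the measures $E\mapsto\int_M g^c\,P(E)f\,dI\,d\theta$ ($f,g$ of zero mean) are absolutely continuous with respect to Lebesgue measure on $\mathbb R$, and for every $f\in L^2(M)$, $$U^tf(I,\theta)=f^*(I)+\int_{\mathbb R}e^{i\beta t}\,dP_\beta(f(I,\theta)).$$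
   Context: $f^*$ is the time average of $f$ along trajectories. The superscript $c$ denotes complex conjugation. The Dirac delta notation means $P(E)f(I,\theta)=\sum_{j\in\mathbb Z'}\mathbf 1_E(jI)\,a_j(I)e^{ij\theta}$, with $\mathbf 1_E$ the indicator function of $E$. *)

theory Defs
  imports "HOL-Analysis.Analysis"
begin

text \<open>
  Elements of \<open>L\<^sup>2(M)\<close> are represented by functions; they are identified when they agree almost
  everywhere, so all identities between them below are stated almost everywhere.
\<close>

definition L2 :: "'a measure \<Rightarrow> ('a \<Rightarrow> complex) set" where
  "L2 M = {f \<in> borel_measurable M. integrable M (\<lambda>x. (cmod (f x))\<^sup>2)}"

definition L2_inner :: "'a measure \<Rightarrow> ('a \<Rightarrow> complex) \<Rightarrow> ('a \<Rightarrow> complex) \<Rightarrow> complex" where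
  "L2_inner M g f = (LINT x|M. cnj (g x) * f x)"

definition L2_norm :: "'a measure \<Rightarrow> ('a \<Rightarrow> complex) \<Rightarrow> real" where
  "L2_norm M f = sqrt (LINT x|M. (cmod (f x))\<^sup>2)"

definition L2_has_sum ::
  "'a measure \<Rightarrow> ('i \<Rightarrow> 'a \<Rightarrow> complex) \<Rightarrow> 'i set \<Rightarrow> ('a \<Rightarrow> complex) \<Rightarrow> bool" where
  "L2_has_sum M F A g \<longleftrightarrow> g \<in> L2 M \<and> (\<forall>j\<in>A. F j \<in> L2 M) \<and>
     ((\<lambda>X. L2_norm M (\<lambda>x. g x - (\<Sum>j\<in>X. F j x))) \<longlongrightarrow> 0) (finite_subsets_at_top A)"

definition L2_infsum ::
  "'a measure \<Rightarrow> ('i \<Rightarrow> 'a \<Rightarrow> complex) \<Rightarrow> 'i set \<Rightarrow> ('a \<Rightarrow> complex)" where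
  "L2_infsum M F A = (SOME g. L2_has_sum M F A g)"

definition orthogonal_projection_on ::
  "'a measure \<Rightarrow> ('a \<Rightarrow> complex) set \<Rightarrow> (('a \<Rightarrow> complex) \<Rightarrow> ('a \<Rightarrow> complex)) \<Rightarrow> bool" where
  "orthogonal_projection_on M H T \<longleftrightarrow>
     (\<forall>f\<in>H. T f \<in> H) \<and>
     (\<forall>f\<in>H. \<forall>g\<in>H. (AE x in M. f x = g x) \<longrightarrow> (AE x in M. T f x = T g x)) \<and>
     (\<forall>f\<in>H. \<forall>g\<in>H. AE x in M. T (\<lambda>y. f y + g y) x = T f x + T g x) \<and>
     (\<forall>f\<in>H. \<forall>c. AE x in M. T (\<lambda>y. c * f y) x = c * T f x) \<and>
     (\<exists>C. \<forall>f\<in>H. L2_norm M (T f) \<le> C * L2_norm M f) \<and>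
     (\<forall>f\<in>H. AE x in M. T (T f) x = T f x) \<and>
     (\<forall>f\<in>H. \<forall>g\<in>H. L2_inner M g (T f) = L2_inner M (T g) f)"

text \<open>Projection-valued measures on the Borel sets of the real line, countably additive in the
  strong operator topology.\<close>

definition projection_valued_measure ::
  "'a measure \<Rightarrow> ('a \<Rightarrow> complex) set \<Rightarrow> (real set \<Rightarrow> ('a \<Rightarrow> complex) \<Rightarrow> ('a \<Rightarrow> complex)) \<Rightarrow> bool" where
  "projection_valued_measure M H P \<longleftrightarrow>
     (\<forall>E\<in>sets borel. orthogonal_projection_on M H (P E)) \<and>
     (\<forall>f\<in>H. AE x in M. P {} f x = 0) \<and>
     (\<forall>f\<in>H. AE x in M. P UNIV f x = f x) \<and>
     (\<forall>E\<in>sets borel. \<forall>F\<in>sets borel. \<forall>f\<in>H. AE x in M. P (E \<inter> F) f x = P E (P F f) x) \<and>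
     (\<forall>A :: nat \<Rightarrow> real set. range A \<subseteq> sets borel \<longrightarrow> disjoint_family A \<longrightarrow>
        (\<forall>f\<in>H. (\<lambda>N. L2_norm M (\<lambda>x. P (\<Union>n. A n) f x - (\<Sum>n<N. P (A n) f x))) \<longlonglongrightarrow> 0))"

text \<open>The integral of a bounded Borel function \<open>\<phi>\<close> against the vector-valued measure
  \<open>E \<mapsto> P(E)f\<close>: the \<open>L\<^sup>2\<close>-limit of the integrals of simple functions converging uniformly
  to \<open>\<phi>\<close> (such sequences exist because \<open>\<phi>\<close> is bounded and Borel).\<close>

definition simple_spectral_integral ::
  "(real set \<Rightarrow> ('a \<Rightarrow> complex) \<Rightarrow> ('a \<Rightarrow> complex)) \<Rightarrow> (real \<Rightarrow> complex) \<Rightarrow>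
   ('a \<Rightarrow> complex) \<Rightarrow> ('a \<Rightarrow> complex)" where
  "simple_spectral_integral P s f = (\<lambda>x. \<Sum>c\<in>range s. c * P (s -` {c}) f x)"

definition has_spectral_integral ::
  "'a measure \<Rightarrow> (real set \<Rightarrow> ('a \<Rightarrow> complex) \<Rightarrow> ('a \<Rightarrow> complex)) \<Rightarrow> (real \<Rightarrow> complex) \<Rightarrow>
   ('a \<Rightarrow> complex) \<Rightarrow> ('a \<Rightarrow> complex) \<Rightarrow> bool" where
  "has_spectral_integral M P \<phi> f u \<longleftrightarrow>
     \<phi> \<in> borel_measurable borel \<and> bounded (range \<phi>) \<and> u \<in> L2 M \<and>
     (\<forall>s :: nat \<Rightarrow> real \<Rightarrow> complex.
        (\<forall>n. simple_function borel (s n)) \<longrightarrow> uniform_limit UNIV s \<phi> sequentially \<longrightarrow>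
        (\<lambda>n. L2_norm M (\<lambda>x. u x - simple_spectral_integral P (s n) f x)) \<longlonglongrightarrow> 0)"

definition complex_measure :: "'a measure \<Rightarrow> ('a set \<Rightarrow> complex) \<Rightarrow> bool" where
  "complex_measure N \<nu> \<longleftrightarrow>
     (\<forall>A :: nat \<Rightarrow> 'a set. range A \<subseteq> sets N \<longrightarrow> disjoint_family A \<longrightarrow>
        (\<lambda>n. \<nu> (A n)) sums \<nu> (\<Union>n. A n))"

definition complex_absolutely_continuous :: "'a measure \<Rightarrow> ('a set \<Rightarrow> complex) \<Rightarrow> bool" where
  "complex_absolutely_continuous N \<nu> \<longleftrightarrow> (\<forall>E\<in>null_sets N. \<nu> E = 0)"

text \<open>The circle is the unit circle of the complex plane; the point with angle \<open>\<theta>\<close> is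
  \<open>z = cis \<theta>\<close>, so that \<open>exp (\<i>j\<theta>)\<close> is \<open>z powi j\<close> and a shift of the angle by \<open>s\<close> is
  multiplication by \<open>cis s\<close>. The measure \<open>d\<theta>\<close> has total mass \<open>2\<pi>\<close>.\<close>

definition circle_measure :: "complex measure" where
  "circle_measure =
     distr (restrict_space lborel {0..<2 * pi}) (restrict_space borel (sphere 0 1)) cis"

definition phase_space :: "real \<Rightarrow> real \<Rightarrow> (real \<times> complex) measure" where
  "phase_space a b = restrict_space lborel {a..b} \<Otimes>\<^sub>M circle_measure"

definition koopman :: "real \<Rightarrow> (real \<times> complex \<Rightarrow> complex) \<Rightarrow> (real \<times> complex \<Rightarrow> complex)" where
  "koopman t f = (\<lambda>(I, z). f (I, z * cis (I * t)))"

definition fourier_coeff :: "(real \<times> complex \<Rightarrow> complex) \<Rightarrow> int \<Rightarrow> real \<Rightarrow> complex" where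
  "fourier_coeff f j I = (LINT z|circle_measure. f (I, z) * cnj (z powi j)) / (2 * pi)"

definition fstar :: "(real \<times> complex \<Rightarrow> complex) \<Rightarrow> (real \<times> complex \<Rightarrow> complex)" where
  "fstar f = (\<lambda>(I, z). fourier_coeff f 0 I)"

definition has_time_average ::
  "(real \<times> complex \<Rightarrow> complex) \<Rightarrow> real \<times> complex \<Rightarrow> complex \<Rightarrow> bool" where
  "has_time_average f x l \<longleftrightarrow>
     ((\<lambda>T. (LBINT t:{0..T}. koopman t f x) /\<^sub>R T) \<longlongrightarrow> l) at_top"

definition zero_mean :: "real \<Rightarrow> real \<Rightarrow> (real \<times> complex \<Rightarrow> complex) set" where
  "zero_mean a b = {f \<in> L2 (phase_space a b). AE x in phase_space a b. fstar f x = 0}"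

definition spectral_term ::
  "real set \<Rightarrow> (real \<times> complex \<Rightarrow> complex) \<Rightarrow> int \<Rightarrow> (real \<times> complex \<Rightarrow> complex)" where
  "spectral_term E f j =
     (\<lambda>(I, z). indicator E (real_of_int j * I) * fourier_coeff f j I * z powi j)"

text \<open>A Fourier series need not converge pointwise; its sum is taken in \<open>L\<^sup>2\<close>.\<close>

definition spectral_proj ::
  "real \<Rightarrow> real \<Rightarrow> real set \<Rightarrow> (real \<times> complex \<Rightarrow> complex) \<Rightarrow> (real \<times> complex \<Rightarrow> complex)" where
  "spectral_proj a b E f = L2_infsum (phase_space a b) (spectral_term E f) (- {0})"

end

theory Submission
  imports Defs
begin

text \<open>
  Almost everywhere identities in \<open>L\<^sup>2(M)\<close> are checked on Fourier coefficients: the characters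
  \<open>z powi j\<close> are complete on the circle, so by Fubini two square-integrable functions with
  the same coefficients \<open>a\<^sub>j(I)\<close> agree, and Parseval's identity holds. On coefficients, \<open>P(E)\<close> is
  multiplication by the indicator of \<open>j I \<in> E\<close> for \<open>j \<noteq> 0\<close>, and the Koopman operator is multiplication
  by \<open>cis (j I t)\<close>, a function of \<open>j I\<close>; projection identities and the spectral integral are then
  pointwise statements about multipliers, and dominated convergence in Parseval's identity gives
  countable additivity. Absolute continuity holds because \<open>{I. j I \<in> E}\<close> is null whenever \<open>E\<close> is
  null and \<open>j \<noteq> 0\<close>. The time average of an integrable function along a rotation differs from its mean
  by a bounded quantity divided by \<open>T\<close>, one period contributing exactly its mean.
\<close>

section \<open>Square-integrable functions\<close>

text \<open>\<open>spectral_proj\<close> is an arbitrary choice among functions that agree only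
  almost everywhere, and the choice means something only once the series is known to have an
  \<open>L2\<close> sum. Completeness of \<open>L2\<close> must therefore come before any property
  of \<open>P(E)\<close>, in a form suited to the unordered net of finite index sets; after that,
  the operator is handled only through its coefficients. Since the index set \<open>int\<close> is
  countable, the exceptional null sets of actions for the separate indices merge into one.

  Splitting off \<open>fstar\<close> is forced by absolute continuity: for \<open>j = 0\<close> the
  frequency \<open>j * I\<close> does not move with \<open>I\<close>, so this mode would put an atom
  at \<open>0\<close>. On all of \<open>L2\<close>, \<open>P(UNIV)\<close> subtracts the mean, so
  the spectral integral formula applies to \<open>f\<close> of any mean, whereas
  \<open>P(UNIV)\<close> is the identity only on \<open>zero_mean\<close>.

  The characters are not normalised: the recurring factor \<open>2 * pi\<close> is their squared
  norm, the total mass of \<open>circle_measure\<close>.\<close>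

lemma borel_measurable_cnj [measurable (raw)]:
  "f \<in> borel_measurable M \<Longrightarrow> (\<lambda>x. cnj (f x)) \<in> borel_measurable M"
  by (rule borel_measurable_continuous_on[OF continuous_on_cnj[OF continuous_on_id]])

lemma L2_measurable [measurable_dest]: "f \<in> L2 M \<Longrightarrow> f \<in> borel_measurable M"
  by (simp add: L2_def)

lemma L2_integrable_square: "f \<in> L2 M \<Longrightarrow> integrable M (\<lambda>x. (cmod (f x))\<^sup>2)"
  by (simp add: L2_def)

lemma L2_integrable_mult:
  assumes "g \<in> L2 M" "f \<in> L2 M"
  shows "integrable M (\<lambda>x. cnj (g x) * f x)"
proof (rule Bochner_Integration.integrable_bound)
  show "integrable M (\<lambda>x. (cmod (g x))\<^sup>2 + (cmod (f x))\<^sup>2)"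
    using assms by (intro Bochner_Integration.integrable_add L2_integrable_square)
  show "(\<lambda>x. cnj (g x) * f x) \<in> borel_measurable M"
    by (intro borel_measurable_times borel_measurable_cnj L2_measurable assms)
  have "a * b \<le> a\<^sup>2 + b\<^sup>2" if "0 \<le> a" "0 \<le> b" for a b :: real
    using sum_squares_bound[of a b] mult_nonneg_nonneg[OF that] by linarith
  then show "AE x in M. norm (cnj (g x) * f x) \<le> norm ((cmod (g x))\<^sup>2 + (cmod (f x))\<^sup>2)"
    by (simp add: norm_mult)
qed

lemma L2_dominated:
  assumes "f \<in> L2 M" "h \<in> borel_measurable M" "AE x in M. cmod (h x) \<le> K * cmod (f x)"
  shows "h \<in> L2 M"
proof -
  have "integrable M (\<lambda>x. (cmod (h x))\<^sup>2)"
  proof (rule Bochner_Integration.integrable_bound)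
    show "integrable M (\<lambda>x. K\<^sup>2 * (cmod (f x))\<^sup>2)"
      using assms(1) by (intro integrable_mult_right L2_integrable_square)
    show "(\<lambda>x. (cmod (h x))\<^sup>2) \<in> borel_measurable M"
      using assms(2) by measurable
    show "AE x in M. norm ((cmod (h x))\<^sup>2) \<le> norm (K\<^sup>2 * (cmod (f x))\<^sup>2)"
      using assms(3)
    proof eventually_elim
      case (elim x)
      then have "(cmod (h x))\<^sup>2 \<le> (K * cmod (f x))\<^sup>2"
        by (intro power_mono) auto
      then show ?case by (simp add: power_mult_distrib)
    qed
  qed
  with assms(2) show ?thesis by (simp add: L2_def)
qed

lemma L2_zero [simp]: "(\<lambda>x. 0) \<in> L2 M"
  by (simp add: L2_def)

lemma L2_cmult:
  assumes "f \<in> L2 M"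
  shows "(\<lambda>x. c * f x) \<in> L2 M"
  by (rule L2_dominated[OF assms, where K = "cmod c"])
     (use assms[THEN L2_measurable] in \<open>auto simp: norm_mult\<close>)

text \<open>The cross term is written as an integrand of \<open>L2_inner\<close>, so its
  integrability gives closure of \<open>L2\<close> under sums, and integrating the identity later
  gives the expansion of a squared norm.\<close>

lemma cmod_add_square: "(cmod (z + w))\<^sup>2 = (cmod z)\<^sup>2 + (cmod w)\<^sup>2 + 2 * Re (cnj w * z)"
  unfolding cmod_power2 by (simp add: power2_eq_square algebra_simps)

lemma L2_add:
  assumes "f \<in> L2 M" "g \<in> L2 M"
  shows "(\<lambda>x. f x + g x) \<in> L2 M"
proof -
  have "integrable M (\<lambda>x. (cmod (f x + g x))\<^sup>2)"
    unfolding cmod_add_square using assms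
    by (intro Bochner_Integration.integrable_add integrable_mult_right integrable_Re
        L2_integrable_mult L2_integrable_square)
  with assms[THEN L2_measurable] show ?thesis by (simp add: L2_def)
qed

lemma L2_diff:
  assumes "f \<in> L2 M" "g \<in> L2 M"
  shows "(\<lambda>x. f x - g x) \<in> L2 M"
  using L2_add[OF assms(1) L2_cmult[OF assms(2), of "-1"]] by simp

lemma L2_sum: "(\<And>i. i \<in> X \<Longrightarrow> F i \<in> L2 M) \<Longrightarrow> (\<lambda>x. \<Sum>i\<in>X. F i x) \<in> L2 M"
  by (induction X rule: infinite_finite_induct) (auto intro: L2_add)

lemma L2_norm_nonneg [simp]: "0 \<le> L2_norm M f"
  by (simp add: L2_norm_def)

lemma L2_norm_square: "(L2_norm M f)\<^sup>2 = (LINT x|M. (cmod (f x))\<^sup>2)"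
  by (simp add: L2_norm_def)

lemma L2_norm_cong_AE:
  assumes "f \<in> L2 M" "g \<in> L2 M" "AE x in M. f x = g x"
  shows "L2_norm M f = L2_norm M g"
  unfolding L2_norm_def using assms(1,2)[THEN L2_measurable] assms(3)
  by (intro arg_cong[where f = sqrt] integral_cong_AE) auto

lemma L2_norm_cmult: "L2_norm M (\<lambda>x. c * f x) = cmod c * L2_norm M f"
  by (simp add: L2_norm_def norm_mult power_mult_distrib real_sqrt_mult)

lemma L2_norm_minus_commute: "L2_norm M (\<lambda>x. f x - g x) = L2_norm M (\<lambda>x. g x - f x)"
  by (simp add: L2_norm_def norm_minus_commute)

lemma L2_norm_eq_0_AE:
  assumes "f \<in> L2 M" "L2_norm M f = 0"
  shows "AE x in M. f x = 0"
  using assms integral_nonneg_eq_0_iff_AE[OF L2_integrable_square[OF assms(1)]]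
  by (simp add: L2_norm_def)

lemma nn_integral_square:
  "f \<in> L2 M \<Longrightarrow> (\<integral>\<^sup>+x. (ennreal (cmod (f x)))\<^sup>2 \<partial>M) = ennreal ((L2_norm M f)\<^sup>2)"
  unfolding L2_norm_square
  by (subst nn_integral_eq_integral[symmetric])
     (auto simp: L2_integrable_square ennreal_power)

text \<open>Obtained from the Cauchy-Schwarz inequality for nonnegative extended integrals, which
  bounds squares; hence the detour through \<open>ennreal\<close> and the square root at the
  end.\<close>

lemma L2_integral_mult_le:
  assumes "g \<in> L2 M" "f \<in> L2 M"
  shows "(LINT x|M. cmod (g x) * cmod (f x)) \<le> L2_norm M g * L2_norm M f"
proof -
  note [measurable] = assms[THEN L2_measurable]
  let ?c = "LINT x|M. cmod (g x) * cmod (f x)"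
  have int: "integrable M (\<lambda>x. cmod (g x) * cmod (f x))"
    using integrable_norm[OF L2_integrable_mult[OF assms]] by (simp add: norm_mult)
  have nn: "0 \<le> ?c" by simp
  have "ennreal (?c\<^sup>2) = (\<integral>\<^sup>+x. ennreal (cmod (g x)) * ennreal (cmod (f x)) \<partial>M)\<^sup>2"
    using nn_integral_eq_integral[OF int] nn
    by (simp add: ennreal_mult'' ennreal_power[symmetric])
  also have "\<dots> \<le> ennreal ((L2_norm M g)\<^sup>2) * ennreal ((L2_norm M f)\<^sup>2)"
    using Cauchy_Schwarz_nn_integral[of "\<lambda>x. ennreal (cmod (g x))" M "\<lambda>x. ennreal (cmod (f x))"]
    by (simp add: nn_integral_square assms)
  also have "\<dots> = ennreal ((L2_norm M g * L2_norm M f)\<^sup>2)"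
    by (simp add: ennreal_mult'' power_mult_distrib)
  finally have "?c\<^sup>2 \<le> (L2_norm M g * L2_norm M f)\<^sup>2"
    by simp
  then show ?thesis
    by (rule power2_le_imp_le) simp
qed

lemma L2_Cauchy_Schwarz:
  assumes "g \<in> L2 M" "f \<in> L2 M"
  shows "cmod (L2_inner M g f) \<le> L2_norm M g * L2_norm M f"
proof -
  have "cmod (L2_inner M g f) \<le> (LINT x|M. cmod (cnj (g x) * f x))"
    unfolding L2_inner_def by (rule integral_norm_bound)
  also have "\<dots> \<le> L2_norm M g * L2_norm M f"
    using L2_integral_mult_le[OF assms] by (simp add: norm_mult)
  finally show ?thesis .
qed

section \<open>Inner product identities and the triangle inequality\<close>

lemma L2_inner_self: "L2_inner M f f = of_real ((L2_norm M f)\<^sup>2)"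
proof -
  have "cnj z * z = of_real ((cmod z)\<^sup>2)" for z
    by (metis complex_norm_square mult.commute)
  then show ?thesis
    unfolding L2_inner_def L2_norm_square by (simp only: integral_complex_of_real)
qed

lemma L2_inner_commute: "L2_inner M g f = cnj (L2_inner M f g)"
proof -
  have "cnj (L2_inner M f g) = (LINT x|M. cnj (cnj (f x) * g x))"
    unfolding L2_inner_def by (rule Bochner_Integration.integral_cnj[symmetric])
  then show ?thesis
    unfolding L2_inner_def by (simp add: mult.commute)
qed

lemma L2_inner_diff_right:
  assumes "g \<in> L2 M" "f \<in> L2 M" "h \<in> L2 M"
  shows "L2_inner M g (\<lambda>x. f x - h x) = L2_inner M g f - L2_inner M g h"
  unfolding L2_inner_def right_diff_distrib
  using assms by (intro Bochner_Integration.integral_diff L2_integrable_mult)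

lemma L2_inner_sum_right:
  assumes "g \<in> L2 M" "\<And>i. i \<in> X \<Longrightarrow> F i \<in> L2 M"
  shows "L2_inner M g (\<lambda>x. \<Sum>i\<in>X. F i x) = (\<Sum>i\<in>X. L2_inner M g (F i))"
  unfolding L2_inner_def sum_distrib_left
  using assms by (intro Bochner_Integration.integral_sum L2_integrable_mult)

lemma L2_inner_sum_left:
  assumes "g \<in> L2 M" "\<And>i. i \<in> X \<Longrightarrow> F i \<in> L2 M"
  shows "L2_inner M (\<lambda>x. \<Sum>i\<in>X. F i x) g = (\<Sum>i\<in>X. L2_inner M (F i) g)"
  by (subst L2_inner_commute, subst L2_inner_sum_right[OF assms], assumption)
     (simp add: L2_inner_commute[symmetric])

lemma L2_norm_add_square:
  assumes "f \<in> L2 M" "g \<in> L2 M"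
  shows "(L2_norm M (\<lambda>x. f x + g x))\<^sup>2 = (L2_norm M f)\<^sup>2 + (L2_norm M g)\<^sup>2 + 2 * Re (L2_inner M g f)"
proof -
  note int = L2_integrable_square[OF assms(1)] L2_integrable_square[OF assms(2)]
    L2_integrable_mult[OF assms(2,1)]
  show ?thesis
    unfolding L2_norm_square cmod_add_square L2_inner_def
    using int integral_Re[OF int(3)] integrable_Re[OF int(3)] by (simp del: times_complex.simps)
qed

lemma L2_norm_triangle:
  assumes "f \<in> L2 M" "g \<in> L2 M"
  shows "L2_norm M (\<lambda>x. f x + g x) \<le> L2_norm M f + L2_norm M g"
proof (rule power2_le_imp_le)
  have "Re (L2_inner M g f) \<le> L2_norm M g * L2_norm M f"
    using complex_Re_le_cmod L2_Cauchy_Schwarz[OF assms(2,1)] by (rule order_trans)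
  then show "(L2_norm M (\<lambda>x. f x + g x))\<^sup>2 \<le> (L2_norm M f + L2_norm M g)\<^sup>2"
    unfolding L2_norm_add_square[OF assms] by (simp add: power2_sum mult.commute)
qed simp

lemma L2_norm_triangle_diff:
  assumes "f \<in> L2 M" "g \<in> L2 M" "h \<in> L2 M"
  shows "L2_norm M (\<lambda>x. f x - h x) \<le> L2_norm M (\<lambda>x. f x - g x) + L2_norm M (\<lambda>x. g x - h x)"
  using L2_norm_triangle[OF L2_diff[OF assms(1,2)] L2_diff[OF assms(2,3)]] by simp

text \<open>Riesz--Fischer: along a sequence whose successive distances are summable, the increments are
  absolutely summable almost everywhere, and Fatou's lemma turns the pointwise limit into an
  \<open>L\<^sup>2\<close>-limit.\<close>

lemma (in finite_measure) L2_summable_increments_converge: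
  assumes u: "\<And>n. u n \<in> L2 M"
    and d: "\<And>n. L2_norm M (\<lambda>x. u (Suc n) x - u n x) \<le> (1 / 2) ^ n"
  obtains g where "g \<in> L2 M" "(\<lambda>n. L2_norm M (\<lambda>x. g x - u n x)) \<longlonglongrightarrow> 0"
proof -
  note [measurable] = u[THEN L2_measurable]
  \<comment> \<open>\<open>lim\<close> is an unspecified value where the sequence diverges; those
    points will form a null set.\<close>
  define g where "g x = lim (\<lambda>n. u n x)" for x
  have g[measurable]: "g \<in> borel_measurable M"
    unfolding g_def by measurable
  \<comment> \<open>Finiteness of the measure enters here: pairing with the constant
    \<open>1\<close> turns the \<open>L2\<close> bounds on the increments into summable
    \<open>L1\<close> bounds.\<close>
  have one: "(\<lambda>x. 1) \<in> L2 M"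
    by (simp add: L2_def)
  have du: "(\<lambda>x. u (Suc n) x - u n x) \<in> L2 M" for n
    by (intro L2_diff u)
  let ?C = "L2_norm M (\<lambda>x. 1)"
  have int: "(\<integral>\<^sup>+x. ennreal (cmod (u (Suc n) x - u n x)) \<partial>M) \<le> ennreal (?C * (1/2) ^ n)" for n
  proof -
    have i: "integrable M (\<lambda>x. cmod (u (Suc n) x - u n x))"
      using integrable_norm[OF L2_integrable_mult[OF one du]] by simp
    have "(LINT x|M. cmod (u (Suc n) x - u n x)) \<le> ?C * L2_norm M (\<lambda>x. u (Suc n) x - u n x)"
      using L2_integral_mult_le[OF one du] by simp
    also have "\<dots> \<le> ?C * (1/2) ^ n"
      by (intro mult_left_mono d) simp
    finally show ?thesis
      using nn_integral_eq_integral[OF i] by (simp add: ennreal_leI)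
  qed
  have "(\<integral>\<^sup>+x. (\<Sum>n. ennreal (cmod (u (Suc n) x - u n x))) \<partial>M)
      = (\<Sum>n. \<integral>\<^sup>+x. ennreal (cmod (u (Suc n) x - u n x)) \<partial>M)"
    by (intro nn_integral_suminf) measurable
  also have "\<dots> \<le> (\<Sum>n. ennreal (?C * (1/2) ^ n))"
    by (intro suminf_le int) auto
  also have "\<dots> = ennreal (\<Sum>n. ?C * (1/2) ^ n)"
    by (intro suminf_ennreal2 summable_mult summable_geometric) auto
  finally have "(\<integral>\<^sup>+x. (\<Sum>n. ennreal (cmod (u (Suc n) x - u n x))) \<partial>M) \<noteq> \<infinity>"
    by (auto simp: top_unique)
  then have "AE x in M. (\<Sum>n. ennreal (cmod (u (Suc n) x - u n x))) \<noteq> \<infinity>"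
    by (intro nn_integral_PInf_AE) auto
  then have lim: "AE x in M. (\<lambda>n. u n x) \<longlonglongrightarrow> g x"
  proof eventually_elim
    case (elim x)
    then have "summable (\<lambda>n. cmod (u (Suc n) x - u n x))"
      by (intro summable_suminf_not_top) auto
    then have "summable (\<lambda>n. u (Suc n) x - u n x)"
      by (rule summable_norm_cancel)
    then have "convergent (\<lambda>n. \<Sum>i<n. u (Suc i) x - u i x)"
      by (simp add: summable_iff_convergent)
    then have "convergent (\<lambda>n. u 0 x + (u n x - u 0 x))"
      by (intro convergent_add convergent_const)
         (simp only: sum_lessThan_telescope[of "\<lambda>n. u n x"])
    then show ?case
      unfolding g_def by (simp add: convergent_LIMSEQ_iff)
  qed
  \<comment> \<open>The right-hand side is the exact geometric sum of the bounds from
    \<open>n\<close> to \<open>n + k - 1\<close>; subtracting the tail is what makes the induction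
    close.\<close>
  have step: "L2_norm M (\<lambda>x. u (n + k) x - u n x) \<le> 2 * (1/2) ^ n - 2 * (1/2) ^ (n + k)" for n k
  proof (induction k)
    case 0
    show ?case by (simp add: L2_norm_def)
  next
    case (Suc k)
    show ?case
      using L2_norm_triangle_diff[OF u[of "Suc (n + k)"] u[of "n + k"] u[of n]] Suc d[of "n + k"]
      by simp
  qed
  have fatou: "(\<integral>\<^sup>+x. (ennreal (cmod (g x - u n x)))\<^sup>2 \<partial>M) \<le> ennreal ((2 * (1/2) ^ n)\<^sup>2)" for n
  proof -
    have "(\<integral>\<^sup>+x. (ennreal (cmod (g x - u n x)))\<^sup>2 \<partial>M)
        = (\<integral>\<^sup>+x. liminf (\<lambda>k. (ennreal (cmod (u (n + k) x - u n x)))\<^sup>2) \<partial>M)"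
    proof (rule nn_integral_cong_AE, use lim in eventually_elim)
      case (elim x)
      have "(\<lambda>k. u (k + n) x) \<longlonglongrightarrow> g x"
        by (rule LIMSEQ_ignore_initial_segment[OF elim])
      then have "(\<lambda>k. ennreal ((cmod (u (n + k) x - u n x))\<^sup>2)) \<longlonglongrightarrow> ennreal ((cmod (g x - u n x))\<^sup>2)"
        unfolding add.commute[of n] by (intro tendsto_intros)
      then show ?case
        by (intro lim_imp_Liminf[symmetric]) (auto simp: ennreal_power)
    qed
    also have "\<dots> \<le> liminf (\<lambda>k. \<integral>\<^sup>+x. (ennreal (cmod (u (n + k) x - u n x)))\<^sup>2 \<partial>M)"
      by (intro nn_integral_liminf) measurable
    also have "\<dots> \<le> ennreal ((2 * (1/2) ^ n)\<^sup>2)"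
    proof (intro Liminf_le always_eventually allI)
      fix k
      have "L2_norm M (\<lambda>x. u (n + k) x - u n x) \<le> 2 * (1/2) ^ n"
        using step[of n k] by (rule order_trans) simp
      then have "(L2_norm M (\<lambda>x. u (n + k) x - u n x))\<^sup>2 \<le> (2 * (1/2) ^ n)\<^sup>2"
        by (rule power_mono) (rule L2_norm_nonneg)
      moreover have "(\<lambda>x. u (n + k) x - u n x) \<in> L2 M"
        by (intro L2_diff u)
      ultimately show "(\<integral>\<^sup>+x. (ennreal (cmod (u (n + k) x - u n x)))\<^sup>2 \<partial>M) \<le> ennreal ((2 * (1/2) ^ n)\<^sup>2)"
        by (simp only: nn_integral_square ennreal_leI)
    qed simp
    finally show ?thesis .
  qed
  \<comment> \<open>The Fatou bound also yields membership: \<open>g - u n\<close> has a finite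
    square integral, and adding \<open>u 0\<close> back to \<open>g - u 0\<close> puts
    \<open>g\<close> itself in \<open>L2\<close>.\<close>
  have gu: "(\<lambda>x. g x - u n x) \<in> L2 M" for n
  proof -
    have "integrable M (\<lambda>x. (cmod (g x - u n x))\<^sup>2)"
      using le_less_trans[OF fatou[of n] ennreal_less_top]
      by (intro integrableI_bounded) (auto simp: ennreal_power)
    then show ?thesis by (simp add: L2_def)
  qed
  have bd: "L2_norm M (\<lambda>x. g x - u n x) \<le> 2 * (1/2) ^ n" for n
  proof (rule power2_le_imp_le)
    show "(L2_norm M (\<lambda>x. g x - u n x))\<^sup>2 \<le> (2 * (1/2) ^ n)\<^sup>2"
      using fatou[of n] unfolding nn_integral_square[OF gu] by (subst (asm) ennreal_le_iff) simp_all
  qed simp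
  have "(\<lambda>n. 2 * (1/2) ^ n :: real) \<longlonglongrightarrow> 0"
    by (intro tendsto_mult_right_zero LIMSEQ_power_zero) simp
  then have "(\<lambda>n. L2_norm M (\<lambda>x. g x - u n x)) \<longlonglongrightarrow> 0"
    by (rule Lim_null_comparison[rotated]) (simp add: bd)
  with L2_add[OF gu[of 0] u[of 0]] show ?thesis
    by (intro that[of g]) simp_all
qed

section \<open>The circle\<close>

lemma space_circle [simp]: "space circle_measure = sphere 0 1"
  by (simp add: circle_measure_def space_restrict_space)

lemma sets_circle [measurable_cong]: "sets circle_measure = sets (restrict_space borel (sphere 0 1))"
  by (simp add: circle_measure_def)

lemma measurable_cis_circle [measurable]:
  "cis \<in> borel \<rightarrow>\<^sub>M restrict_space borel (sphere 0 1)"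
  by (intro measurable_restrict_space2 borel_measurable_continuous_onI continuous_on_cis continuous_on_id) auto

lemma measurable_cis_circle_restrict [measurable]:
  "cis \<in> restrict_space lborel A \<rightarrow>\<^sub>M restrict_space borel (sphere 0 1)"
  using measurable_restrict_space1[OF measurable_cis_circle] by (simp cong: measurable_cong_sets)

lemma circle_id_measurable [measurable]: "(\<lambda>z. z) \<in> borel_measurable circle_measure"
  by (simp add: measurable_cong_sets[OF sets_circle refl] measurable_restrict_space1)

text \<open>\<open>cis\<close> maps the whole line into the circle, so a function known only on the
  circle pulls back to a Borel function on all of the line, where it can be translated.\<close>

lemma measurable_comp_cis:
  "F \<in> circle_measure \<rightarrow>\<^sub>M N \<Longrightarrow> (\<lambda>\<theta>. F (cis \<theta>)) \<in> borel \<rightarrow>\<^sub>M N"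
  using measurable_comp[OF measurable_cis_circle, of F N]
  by (simp add: comp_def measurable_cong_sets[OF sets_circle refl])

lemma nn_integral_circle:
  assumes "F \<in> borel_measurable circle_measure"
  shows "(\<integral>\<^sup>+z. F z \<partial>circle_measure) = (\<integral>\<^sup>+\<theta>. F (cis \<theta>) * indicator {0..<2*pi} \<theta> \<partial>lborel)"
proof -
  have "(\<integral>\<^sup>+z. F z \<partial>circle_measure) = (\<integral>\<^sup>+\<theta>. F (cis \<theta>) \<partial>restrict_space lborel {0..<2*pi})"
    using assms unfolding circle_measure_def by (intro nn_integral_distr) (simp_all cong: measurable_cong_sets)
  then show ?thesis
    by (simp add: nn_integral_restrict_space)
qed

lemma emeasure_circle_space: "emeasure circle_measure (sphere 0 1) = ennreal (2 * pi)"
  using nn_integral_circle[of "\<lambda>_. 1"] by simp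

lemma finite_measure_circle: "finite_measure circle_measure"
  by (intro finite_measureI) (simp add: emeasure_circle_space)

lemma measure_circle_space: "measure circle_measure (sphere 0 1) = 2 * pi"
  by (simp add: measure_def emeasure_circle_space)

section \<open>Rotation invariance of the circle measure\<close>

lemma measurable_rotate [measurable]:
  "(\<lambda>z. z * cis s) \<in> circle_measure \<rightarrow>\<^sub>M circle_measure"
proof -
  have "(\<lambda>z. z * cis s) \<in> circle_measure \<rightarrow>\<^sub>M restrict_space borel (sphere 0 1)"
    by (intro measurable_restrict_space2) (auto simp: norm_mult)
  then show ?thesis
    by (simp cong: measurable_cong_sets add: sets_circle)
qed

text \<open>The shifted window \<open>{s..<p+s}\<close> is cut at \<open>p\<close>, and the part
  sticking out is moved back by one period to fill \<open>{0..<s}\<close>.\<close>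

lemma nn_integral_periodic_shift:
  fixes g :: "real \<Rightarrow> ennreal"
  assumes [measurable]: "g \<in> borel_measurable borel"
    and per: "\<And>x. g (x + p) = g x" and s: "0 \<le> s" "s < p"
  shows "(\<integral>\<^sup>+x. g (x + s) * indicator {0..<p} x \<partial>lborel) = (\<integral>\<^sup>+x. g x * indicator {0..<p} x \<partial>lborel)"
proof -
  have 1: "(\<integral>\<^sup>+x. g (x + s) * indicator {0..<p} x \<partial>lborel) = (\<integral>\<^sup>+x. g x * indicator {s..<p+s} x \<partial>lborel)"
    by (subst nn_integral_real_affine[where c = 1 and t = s])
       (auto intro!: nn_integral_cong simp: indicator_def add.commute)
  have 2: "(\<integral>\<^sup>+x. g x * indicator {p..<p+s} x \<partial>lborel) = (\<integral>\<^sup>+x. g x * indicator {0..<s} x \<partial>lborel)"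
    by (subst nn_integral_real_affine[where c = 1 and t = p])
       (auto intro!: nn_integral_cong simp: indicator_def per[unfolded add.commute[of _ p]])
  have "(\<integral>\<^sup>+x. g x * indicator {s..<p+s} x \<partial>lborel)
      = (\<integral>\<^sup>+x. g x * indicator {s..<p} x + g x * indicator {p..<p+s} x \<partial>lborel)"
    using s by (intro nn_integral_cong) (auto simp: indicator_def)
  also have "\<dots> = (\<integral>\<^sup>+x. g x * indicator {s..<p} x + g x * indicator {0..<s} x \<partial>lborel)"
    by (simp add: nn_integral_add 2)
  also have "\<dots> = (\<integral>\<^sup>+x. g x * indicator {0..<p} x \<partial>lborel)"
    using s by (intro nn_integral_cong) (auto simp: indicator_def)
  finally show ?thesis
    using 1 by simp
qed

lemma circle_rotation_invariant: "distr circle_measure circle_measure (\<lambda>z. z * cis s) = circle_measure"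
proof (rule measure_eqI)
  fix A assume "A \<in> sets (distr circle_measure circle_measure (\<lambda>z. z * cis s))"
  then have A[measurable]: "A \<in> sets circle_measure"
    by simp
  \<comment> \<open>The angle reduced modulo \<open>2 * pi\<close>, since the periodic shift lemma
    takes shifts shorter than one period.\<close>
  define r where "r = s - 2 * pi * of_int \<lfloor>s / (2 * pi)\<rfloor>"
  have r: "0 \<le> r" "r < 2 * pi"
  proof -
    have "r = 2 * pi * frac (s / (2 * pi))"
      by (simp add: r_def frac_def field_simps)
    then show "0 \<le> r" "r < 2 * pi"
      by (simp_all add: frac_lt_1)
  qed
  have cis_s: "cis s = cis r"
  proof -
    have "cis (2 * pi * of_int k) = 1" for k
      by (intro cis_multiple_2pi) auto
    then show ?thesis
      by (simp add: r_def cis_divide[symmetric])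
  qed
  let ?g = "\<lambda>\<theta>. indicator A (cis \<theta>) :: ennreal"
  have [measurable]: "?g \<in> borel_measurable borel"
    by (intro measurable_comp_cis) simp
  have "emeasure (distr circle_measure circle_measure (\<lambda>z. z * cis s)) A
      = (\<integral>\<^sup>+z. indicator A z \<partial>distr circle_measure circle_measure (\<lambda>z. z * cis s))"
    by simp
  also have "\<dots> = (\<integral>\<^sup>+z. indicator A (z * cis r) \<partial>circle_measure)"
    unfolding cis_s by (intro nn_integral_distr) auto
  also have "\<dots> = (\<integral>\<^sup>+\<theta>. ?g (\<theta> + r) * indicator {0..<2*pi} \<theta> \<partial>lborel)"
    by (subst nn_integral_circle) (auto simp: cis_mult)
  also have "\<dots> = (\<integral>\<^sup>+\<theta>. ?g \<theta> * indicator {0..<2*pi} \<theta> \<partial>lborel)"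
    by (intro nn_integral_periodic_shift r) (auto simp: cis_mult[symmetric])
  also have "\<dots> = emeasure circle_measure A"
    using nn_integral_circle[of "indicator A"] by simp
  finally show "emeasure (distr circle_measure circle_measure (\<lambda>z. z * cis s)) A = emeasure circle_measure A" .
qed simp

text \<open>Stated for measurable \<open>F\<close>, so that it applies to every section of a
  function on the phase space, whether or not that section is integrable.\<close>

lemma integral_circle_rotate:
  fixes F :: "complex \<Rightarrow> 'a::{banach, second_countable_topology}"
  assumes "F \<in> borel_measurable circle_measure"
  shows "(LINT z|circle_measure. F (z * cis s)) = (LINT z|circle_measure. F z)"
  using integral_distr[of "\<lambda>z. z * cis s" circle_measure circle_measure F] assms
  by (simp add: circle_rotation_invariant)

lemma integrable_circle_rotate:
  fixes F :: "complex \<Rightarrow> 'a::{banach, second_countable_topology}"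
  assumes "integrable circle_measure F"
  shows "integrable circle_measure (\<lambda>z. F (z * cis s))"
  using integrable_distr[of "\<lambda>z. z * cis s" circle_measure circle_measure F] assms
  by (simp add: circle_rotation_invariant)

section \<open>Characters of the circle and their integrals\<close>

lemma borel_measurable_powi [measurable (raw)]:
  "f \<in> borel_measurable M \<Longrightarrow> (\<lambda>x. f x powi j :: complex) \<in> borel_measurable M"
  unfolding power_int_def by (cases "0 \<le> j") simp_all

lemma norm_powi_circle: "z \<in> sphere 0 1 \<Longrightarrow> cmod (z powi j) = 1"
  by (simp add: norm_power_int)

lemma cis_powi: "cis x powi j = cis (of_int j * x)"
  by (auto simp: power_int_def Complex.DeMoivre cis_inverse)

lemma integrable_circle_mult_powi:
  assumes "integrable circle_measure F"
  shows "integrable circle_measure (\<lambda>z. F z * z powi j)"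
  using assms by (rule Bochner_Integration.integrable_bound)
     (use assms in \<open>auto simp: norm_mult norm_powi_circle\<close>)

text \<open>For \<open>j \<noteq> 0\<close>, rotation invariance makes the integral equal to its own
  negative, so no antiderivative is computed.\<close>

lemma integral_powi_circle:
  "(LINT z|circle_measure. z powi j) = (if j = 0 then 2 * pi else 0)"
proof (cases "j = 0")
  case False
  let ?s = "pi / of_int j" \<comment> \<open>this rotation changes the sign of \<open>z powi j\<close>\<close>
  have "(LINT z|circle_measure. z powi j) = (LINT z|circle_measure. (z * cis ?s) powi j)"
    by (intro integral_circle_rotate[symmetric]) simp
  also have "\<dots> = (LINT z|circle_measure. - (z powi j))"
    using False by (simp add: power_int_mult_distrib cis_powi)
  finally show ?thesis
    using False by simp
qed (simp add: measure_circle_space scaleR_conv_of_real)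

lemma powi_mult_cnj_circle:
  assumes "z \<in> sphere 0 1"
  shows "z powi j * cnj (z powi k) = z powi (j - k)"
proof -
  have "cnj z = inverse z"
    using assms by (simp add: inverse_eq_divide complex_div_cnj[of 1])
  moreover have "z \<noteq> 0"
    using assms by auto
  ultimately show ?thesis
    by (simp add: power_int_diff power_int_inverse divide_inverse)
qed

subsection \<open>Completeness of the characters\<close>

text \<open>On the circle a real linear form is a combination of \<open>z\<close> and \<open>z powi (-1)\<close>, so every polynomial
  in the real coordinates is a trigonometric polynomial.\<close>

lemma real_polynomial_function_orthogonal:
  assumes "real_polynomial_function p"
    and "integrable circle_measure F" "\<And>j::int. (LINT z|circle_measure. F z * z powi j) = 0"
  shows "integrable circle_measure (\<lambda>z. F z * of_real (p z)) \<and>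
    (\<forall>j::int. (LINT z|circle_measure. (F z * of_real (p z)) * z powi j) = 0)"
  using assms
proof (induction arbitrary: F rule: real_polynomial_function.induct)
  case (linear f)
  interpret bounded_linear f by fact
  \<comment> \<open>From \<open>x = (z + z powi (-1)) / 2\<close> and
    \<open>y = (z - z powi (-1)) / (2 * \<i>)\<close> inserted into
    \<open>x * f 1 + y * f \<i>\<close>; reality of \<open>f\<close> makes the second coefficient
    \<open>cnj c\<close>.\<close>
  define c where "c = (of_real (f 1) - \<i> * of_real (f \<i>)) / 2"
  have fz: "of_real (f z) = c * z powi 1 + cnj c * z powi (-1)" if "z \<in> space circle_measure" for z
  proof -
    have "z = Re z *\<^sub>R 1 + Im z *\<^sub>R \<i>"
      by (simp add: complex_eq_iff)
    then have "f z = Re z * f 1 + Im z * f \<i>"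
      by (metis add scale real_scaleR_def)
    moreover have "z powi (-1) = cnj z"
      using powi_mult_cnj_circle[of z 0 1] that by simp
    ultimately show ?thesis
      by (simp only: power_int_1_right) (simp add: c_def complex_eq_iff diff_divide_distrib)
  qed
  have *: "(F z * of_real (f z)) * z powi j = c * (F z * z powi (1 + j)) + cnj c * (F z * z powi (j - 1))"
    if "z \<in> space circle_measure" for z and j :: int
  proof -
    have "z \<noteq> 0" using that by auto
    then show ?thesis
      unfolding fz[OF that] by (simp add: power_int_add power_int_diff field_simps power_int_minus)
  qed
  have i: "integrable circle_measure (\<lambda>z. c * (F z * z powi (1 + j)) + cnj c * (F z * z powi (j - 1)))" for j
    using linear.prems by (intro Bochner_Integration.integrable_add integrable_mult_right integrable_circle_mult_powi)
  have "integrable circle_measure (\<lambda>z. (F z * of_real (f z)) * z powi 0)"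
    by (subst Bochner_Integration.integrable_cong[OF refl *]) (assumption, rule i)
  moreover have "(LINT z|circle_measure. (F z * of_real (f z)) * z powi j) = 0" for j
    by (subst Bochner_Integration.integral_cong[OF refl *], assumption)
       (use linear.prems in \<open>simp add: integrable_circle_mult_powi\<close>)
  ultimately show ?case by simp
next
  case (const c)
  have "(F z * of_real c) * z powi j = of_real c * (F z * z powi j)" for z j
    by simp
  then have "(LINT z|circle_measure. (F z * of_real c) * z powi j) = 0" for j
    using const(2)[of j] by (simp only: integral_mult_right_zero mult_zero_right)
  with const show ?case
    by simp
next
  case (add f g)
  note * = add.IH(1)[OF add.prems] add.IH(2)[OF add.prems]
  show ?case
    using * by (simp add: distrib_left distrib_right integrable_circle_mult_powi)
next
  case (mult f g)
  \<comment> \<open>The hypothesis for \<open>g\<close> is applied to \<open>F * f\<close> in place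
    of \<open>F\<close>. This is why the induction generalises over \<open>F\<close> and carries
    orthogonality to every character, not just a vanishing integral.\<close>
  note 1 = mult.IH(1)[OF mult.prems]
  have "integrable circle_measure (\<lambda>z. F z * of_real (f z))"
    using 1 by blast
  from mult.IH(2)[OF this] 1 show ?case
    by (simp add: mult.assoc)
qed

text \<open>By Stone-Weierstrass \<open>g\<close> is uniformly close on the circle to a polynomial,
  whose pairing with \<open>F\<close> vanishes; the error is at most the uniform distance times the
  \<open>L1\<close> norm of \<open>F\<close>.\<close>

lemma continuous_orthogonal_circle:
  fixes g :: "complex \<Rightarrow> real"
  assumes F: "integrable circle_measure F" "\<And>j::int. (LINT z|circle_measure. F z * z powi j) = 0"
    and g: "continuous_on UNIV g"
  shows "(LINT z|circle_measure. F z * of_real (g z)) = 0"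
proof (rule ccontr)
  let ?K = "LINT z|circle_measure. cmod (F z)"
  let ?J = "LINT z|circle_measure. F z * of_real (g z)"
  assume "?J \<noteq> 0"
  have K: "0 \<le> ?K" by simp
  \<comment> \<open>Chosen so that \<open>e * ?K < e * (2 * (?K + 1)) = cmod ?J\<close>, a
    contradiction; the \<open>+ 1\<close> keeps the denominator positive when
    \<open>?K = 0\<close>.\<close>
  define e where "e = cmod ?J / (2 * (?K + 1))"
  have "0 < e"
    using \<open>?J \<noteq> 0\<close> K by (simp add: e_def add_nonneg_pos)
  then obtain p where p: "real_polynomial_function p" "\<And>z. z \<in> sphere 0 1 \<Longrightarrow> \<bar>g z - p z\<bar> < e"
    using Stone_Weierstrass_real_polynomial_function[of "sphere 0 1" g e] g
      continuous_on_subset by (metis compact_sphere subset_UNIV)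
  note P = real_polynomial_function_orthogonal[OF p(1) F]
  have Jp: "(LINT z|circle_measure. F z * of_real (p z)) = 0"
    using P[THEN conjunct2, rule_format, of 0] by simp
  have [measurable]: "g \<in> borel_measurable borel"
    using g by (rule borel_measurable_continuous_onI)
  have [measurable]: "F \<in> borel_measurable circle_measure"
    using F(1) by simp
  have [measurable]: "p \<in> borel_measurable borel"
    by (intro borel_measurable_continuous_onI continuous_on_polymonial_function)
       (simp add: p(1) flip: real_polynomial_function_eq)
  have bd: "cmod (F z * of_real (g z) - F z * of_real (p z)) \<le> e * cmod (F z)"
    if "z \<in> space circle_measure" for z
  proof -
    have "cmod (F z * of_real (g z) - F z * of_real (p z)) = cmod (F z) * \<bar>g z - p z\<bar>"
      by (simp add: norm_mult flip: right_diff_distrib of_real_diff)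
    also have "\<dots> \<le> cmod (F z) * e"
      using p(2)[of z] that by (intro mult_left_mono) auto
    finally show ?thesis by (simp add: mult.commute)
  qed
  have d: "integrable circle_measure (\<lambda>z. F z * of_real (g z) - F z * of_real (p z))"
  proof (rule Bochner_Integration.integrable_bound)
    show "integrable circle_measure (\<lambda>z. e * cmod (F z))"
      using F(1) by simp
    show "AE z in circle_measure. cmod (F z * of_real (g z) - F z * of_real (p z)) \<le> norm (e * cmod (F z))"
      using bd by (intro AE_I2) (use \<open>0 < e\<close> in auto)
  qed measurable
  have "integrable circle_measure (\<lambda>z. F z * of_real (g z))"
    using Bochner_Integration.integrable_add[OF d conjunct1[OF P]] by simp
  then have "?J = (LINT z|circle_measure. F z * of_real (g z) - F z * of_real (p z))"
    using P by (simp add: Jp)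
  also have "cmod \<dots> \<le> (LINT z|circle_measure. e * cmod (F z))"
    by (rule order_trans[OF integral_norm_bound])
       (intro integral_mono integrable_norm bd integrable_mult_right d F(1))
  also have "\<dots> = e * ?K"
    by simp
  also have "\<dots> < e * (2 * (?K + 1))"
  proof (rule mult_strict_left_mono)
    have "x < 2 * (x + 1)" if "0 \<le> x" for x :: real
      using that by simp
    then show "?K < 2 * (?K + 1)"
      using K .
  qed fact
  also have "\<dots> = cmod ?J"
  proof (rule iffD1[OF nonzero_eq_divide_eq e_def])
    have "2 * (x + 1) \<noteq> 0" if "0 \<le> x" for x :: real
      using that by simp
    then show "2 * (?K + 1) \<noteq> 0"
      using K .
  qed
  finally show False by simp
qed

text \<open>Traces of closed sets form an intersection-stable generator, and their indicators are
  limits of continuous functions: the two properties used in the induction over measurable sets of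
  the circle.\<close>

lemma sets_circle_closed:
  "sets circle_measure = sigma_sets (sphere 0 1) {sphere 0 1 \<inter> C |C. closed C}"
proof -
  have "sphere 0 1 \<in> sigma_sets UNIV (Collect closed :: complex set set)"
    by (intro sigma_sets.Basic) simp
  then have "(\<inter>) (sphere 0 1) ` sigma_sets UNIV (Collect closed)
      = sigma_sets (sphere 0 1) ((\<inter>) (sphere 0 1) ` Collect closed :: complex set set)"
    by (rule sigma_sets_Int) simp
  moreover have "sets borel = sigma_sets UNIV (Collect closed :: complex set set)"
    by (simp add: borel_eq_closed)
  ultimately show ?thesis
    by (simp add: sets_circle sets_restrict_space image_Collect)
qed

text \<open>An integrable function vanishes almost everywhere once its integral over each measurable
  set does. Closed sets are reached by continuous approximation and dominated convergence, all
  others by the pi-lambda principle.\<close>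

lemma circle_characters_complete:
  assumes F: "integrable circle_measure F" "\<And>j::int. (LINT z|circle_measure. F z * z powi j) = 0"
  shows "AE z in circle_measure. F z = 0"
proof (rule sigma_finite_measure.density_zero[OF _ F(1)])
  show "sigma_finite_measure circle_measure"
    using finite_measure_circle by (rule finite_measure.axioms)
  have [measurable]: "F \<in> borel_measurable circle_measure"
    using F(1) by simp
  have intA: "set_integrable circle_measure A F" if "A \<in> sets circle_measure" for A
    unfolding set_integrable_def using that F(1) by (rule integrable_mult_indicator)
  \<comment> \<open>The case \<open>j = 0\<close>; it is what allows passing to complements.\<close>
  have whole: "(LINT z:sphere 0 1|circle_measure. F z) = 0"
    using F(2)[of 0] unfolding set_lebesgue_integral_def
    by (subst Bochner_Integration.integral_cong[OF refl, of _ _ F]) auto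
  fix A assume "A \<in> sets circle_measure"
  then have A: "A \<in> sigma_sets (sphere 0 1) {sphere 0 1 \<inter> C |C. closed C}"
    by (simp add: sets_circle_closed)
  have stable: "Int_stable {sphere 0 1 \<inter> C |C. closed (C :: complex set)}"
  proof (rule Int_stableI)
    fix A B :: "complex set"
    assume "A \<in> {sphere 0 1 \<inter> C |C. closed C}" "B \<in> {sphere 0 1 \<inter> C |C. closed C}"
    then obtain C D where "A = sphere 0 1 \<inter> C" "B = sphere 0 1 \<inter> D" "closed C" "closed D"
      by blast
    then have "A \<inter> B = sphere 0 1 \<inter> (C \<inter> D)" "closed (C \<inter> D)"
      by auto
    then show "A \<inter> B \<in> {sphere 0 1 \<inter> C |C. closed C}"
      by blast
  qed
  have sub: "{sphere 0 1 \<inter> C |C. closed (C :: complex set)} \<subseteq> Pow (sphere 0 1)"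
    by auto
  from stable sub A show "(LINT z:A|circle_measure. F z) = 0"
  proof (induction rule: sigma_sets_induct_disjoint)
    case (basic A)
    then obtain C where C: "A = sphere 0 1 \<inter> C" "closed C" by auto
    show ?case
    \<comment> \<open>\<open>infdist\<close> to the empty set is \<open>0\<close> by convention, so
      the approximating functions would be constantly \<open>1\<close> there instead of tending to
      the indicator.\<close>
    proof (cases "C = {}")
      case False
      \<comment> \<open>continuous functions decreasing to the indicator of \<open>C\<close>\<close>
      define g where "g n z = max 0 (1 - real n * infdist z C)" for n z
      have cont: "continuous_on UNIV (g n)" for n
        unfolding g_def by (intro continuous_intros)
      have [measurable]: "g n \<in> borel_measurable borel" for n
        by (rule borel_measurable_continuous_onI[OF cont])
      have "(\<lambda>n. LINT z|circle_measure. F z * of_real (g n z)) \<longlonglongrightarrow> (LINT z|circle_measure. indicator A z *\<^sub>R F z)"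
      proof (rule integral_dominated_convergence)
        show "(\<lambda>z. indicator A z *\<^sub>R F z) \<in> borel_measurable circle_measure"
        proof -
          have "A \<in> sets circle_measure"
            using C by (auto simp: sets_circle sets_restrict_space)
          then show ?thesis by measurable
        qed
        show "integrable circle_measure (\<lambda>z. cmod (F z))"
          using F(1) by simp
        show "AE z in circle_measure. (\<lambda>n. F z * of_real (g n z)) \<longlonglongrightarrow> indicator A z *\<^sub>R F z"
        proof (rule AE_I2)
          fix z assume z: "z \<in> space circle_measure"
          have "(\<lambda>n. g n z) \<longlonglongrightarrow> indicator A z"
          proof (cases "z \<in> C")
            case True
            with z C show ?thesis by (simp add: g_def)
          next
            case out: False
            then have d: "0 < infdist z C"
              using C False by (metis in_closed_iff_infdist_zero infdist_nonneg less_le)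
            obtain N where N: "1 < real N * infdist z C"
              using ex_less_of_nat_mult[OF d] by auto
            have "g n z = 0" if "N \<le> n" for n
            proof -
              have "real N * infdist z C \<le> real n * infdist z C"
                using that d by (intro mult_right_mono) auto
              with N show ?thesis by (simp add: g_def)
            qed
            then have "(\<lambda>n. g n z) \<longlonglongrightarrow> 0"
              by (intro tendsto_eventually) (auto simp: eventually_sequentially)
            with out C show ?thesis by simp
          qed
          then have "(\<lambda>n. F z * of_real (g n z)) \<longlonglongrightarrow> F z * of_real (indicator A z)"
            by (intro tendsto_intros)
          then show "(\<lambda>n. F z * of_real (g n z)) \<longlonglongrightarrow> indicator A z *\<^sub>R F z"
            by (simp add: scaleR_conv_of_real mult.commute)
        qed
        show "AE z in circle_measure. norm (F z * of_real (g n z)) \<le> cmod (F z)" for n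
          by (auto simp: norm_mult g_def infdist_nonneg intro!: mult_left_le)
      qed measurable
      then show ?thesis
        unfolding set_lebesgue_integral_def
        by (simp add: continuous_orthogonal_circle[OF F cont] LIMSEQ_const_iff)
    qed (simp add: C set_lebesgue_integral_def)
  next
    case empty
    show ?case by (simp add: set_lebesgue_integral_def)
  next
    case (compl A)
    then have A: "A \<in> sets circle_measure"
      by (simp add: sets_circle_closed)
    then have sub: "A \<subseteq> sphere 0 1"
      using sets.sets_into_space by fastforce
    have "(LINT z:A \<union> (sphere 0 1 - A)|circle_measure. F z)
        = (LINT z:A|circle_measure. F z) + (LINT z:sphere 0 1 - A|circle_measure. F z)"
      using A sets.compl_sets[OF A] by (intro set_integral_Un intA) auto
    moreover have "A \<union> (sphere 0 1 - A) = sphere 0 1"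
      using sub by auto
    ultimately show ?case
      using compl whole by simp
  next
    case (union A)
    then have A: "A i \<in> sets circle_measure" for i
      by (auto simp: sets_circle_closed)
    have "(LINT z:(\<Union>i. A i)|circle_measure. F z) = (\<Sum>i. (LINT z:A i|circle_measure. F z))"
      using A union by (intro lebesgue_integral_countable_add intA) (auto simp: disjoint_family_on_def)
    then show ?case
      using union by simp
  qed
qed

section \<open>Fourier expansion on the phase space\<close>

abbreviation action_space :: "real \<Rightarrow> real \<Rightarrow> real measure" where
  "action_space a b \<equiv> restrict_space lborel {a..b}"

lemma space_action [simp]: "space (action_space a b) = {a..b}"
  by (simp add: space_restrict_space)

lemma finite_measure_action: "finite_measure (action_space a b)"
  by (intro finite_measureI) (cases "a \<le> b"; simp add: space_restrict_space emeasure_restrict_space)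

lemma pair_sigma_finite_phase: "pair_sigma_finite (action_space a b) circle_measure"
  using finite_measure_action[of a b] finite_measure_circle
  by (intro pair_sigma_finite.intro finite_measure.axioms(1))

lemma space_phase: "space (phase_space a b) = {a..b} \<times> sphere 0 1"
  by (simp add: phase_space_def space_pair_measure space_restrict_space)

lemma sets_phase [measurable_cong]:
  "sets (phase_space a b) = sets (action_space a b \<Otimes>\<^sub>M circle_measure)"
  by (simp add: phase_space_def)

lemma finite_measure_phase: "finite_measure (phase_space a b)"
  unfolding phase_space_def
  by (intro finite_measure_pair_measure finite_measure_action finite_measure_circle)

lemma action_id_measurable [measurable]: "(\<lambda>I. I) \<in> borel_measurable (action_space a b)"
  using measurable_restrict_space1[of "\<lambda>x. x" lborel borel] by simp

lemma fst_phase_measurable [measurable]: "fst \<in> phase_space a b \<rightarrow>\<^sub>M action_space a b"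
  by (simp add: phase_space_def)

lemma snd_phase_measurable [measurable]: "snd \<in> phase_space a b \<rightarrow>\<^sub>M circle_measure"
  by (simp add: phase_space_def)

text \<open>A null set \<open>N\<close> of actions lifts to \<open>N \<times> sphere 0 1\<close>,
  which is null because the circle has finite measure.\<close>

lemma AE_phase_fst:
  assumes "AE I in action_space a b. Q I"
  shows "AE x in phase_space a b. Q (fst x)"
proof -
  interpret pair_sigma_finite "action_space a b" circle_measure
    by (rule pair_sigma_finite_phase)
  from assms obtain N where N: "{I \<in> space (action_space a b). \<not> Q I} \<subseteq> N"
    "emeasure (action_space a b) N = 0" "N \<in> sets (action_space a b)"
    by (rule AE_E)
  have "emeasure (phase_space a b) (N \<times> sphere 0 1) = 0"
    using M2.emeasure_pair_measure_Times[OF N(3), of "sphere 0 1"] sets.top[of circle_measure] N(2)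
    by (simp add: phase_space_def)
  moreover have "N \<times> sphere 0 1 \<in> sets (phase_space a b)"
    using N(3) sets.top[of circle_measure] by (auto simp: phase_space_def)
  ultimately show ?thesis
    by (intro AE_I[of _ _ "N \<times> sphere 0 1"])
       (use N(1) in \<open>auto simp: space_phase space_restrict_space\<close>)
qed

lemma AE_phase_section:
  assumes "AE x in phase_space a b. Q x"
  shows "AE I in action_space a b. AE z in circle_measure. Q (I, z)"
  using assms unfolding phase_space_def
  by (rule pair_sigma_finite.AE_pair[OF pair_sigma_finite_phase])

lemma phase_section_measurable:
  "f \<in> borel_measurable (phase_space a b) \<Longrightarrow> I \<in> {a..b} \<Longrightarrow> (\<lambda>z. f (I, z)) \<in> borel_measurable circle_measure"
  unfolding phase_space_def
  by (rule measurable_compose[OF measurable_Pair1']) simp_all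

lemma AE_section_L2:
  assumes "f \<in> L2 (phase_space a b)"
  shows "AE I in action_space a b. (\<lambda>z. f (I, z)) \<in> L2 circle_measure"
proof -
  have "AE I in action_space a b. integrable circle_measure (\<lambda>z. (cmod (f (I, z)))\<^sup>2)"
    using L2_integrable_square[OF assms] unfolding phase_space_def
    by (rule pair_sigma_finite.AE_integrable_fst'[OF pair_sigma_finite_phase])
  then show ?thesis
    using AE_space
  proof eventually_elim
    case (elim I)
    then show ?case
      using phase_section_measurable[OF L2_measurable[OF assms], of I] by (simp add: L2_def)
  qed
qed

lemma powi_L2_circle: "(\<lambda>z. z powi j) \<in> L2 circle_measure"
proof -
  have "integrable circle_measure (\<lambda>z. (cmod (z powi j))\<^sup>2) \<longleftrightarrow> integrable circle_measure (\<lambda>z. 1 :: real)"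
    by (intro Bochner_Integration.integrable_cong) (simp_all add: norm_powi_circle)
  then show ?thesis
    using finite_measure.integrable_const[OF finite_measure_circle, of "1 :: real"]
    by (simp add: L2_def)
qed

lemma L2_norm_powi_circle: "L2_norm circle_measure (\<lambda>z. z powi j) = sqrt (2 * pi)"
proof -
  have "(LINT z|circle_measure. (cmod (z powi j))\<^sup>2) = (LINT z|circle_measure. 1)"
    by (intro Bochner_Integration.integral_cong) (simp_all add: norm_powi_circle)
  then show ?thesis
    by (simp add: L2_norm_def measure_circle_space)
qed

section \<open>Fourier coefficients as functions of the action\<close>

lemma fourier_coeff_inner:
  "fourier_coeff f j I = L2_inner circle_measure (\<lambda>z. z powi j) (\<lambda>z. f (I, z)) / (2 * pi)"
  by (simp add: fourier_coeff_def L2_inner_def mult.commute)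

lemma AE_section_integrable:
  assumes "f \<in> L2 (phase_space a b)"
  shows "AE I in action_space a b. \<forall>j::int. integrable circle_measure (\<lambda>z. f (I, z) * cnj (z powi j))"
  using AE_section_L2[OF assms]
proof eventually_elim
  case (elim I)
  then show ?case
    using L2_integrable_mult[OF powi_L2_circle elim] by (simp add: mult.commute)
qed

lemma fourier_coeff_measurable [measurable]:
  assumes [measurable]: "f \<in> borel_measurable (phase_space a b)"
  shows "fourier_coeff f j \<in> borel_measurable (action_space a b)"
proof -
  interpret pair_sigma_finite "action_space a b" circle_measure
    by (rule pair_sigma_finite_phase)
  have "(\<lambda>p. f p * cnj (snd p powi j)) \<in> borel_measurable (phase_space a b)"
    by measurable
  then have "(\<lambda>(I, z). f (I, z) * cnj (z powi j)) \<in> borel_measurable (action_space a b \<Otimes>\<^sub>M circle_measure)"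
    by (simp add: phase_space_def case_prod_beta')
  then have "(\<lambda>I. LINT z|circle_measure. f (I, z) * cnj (z powi j)) \<in> borel_measurable (action_space a b)"
    by (rule M2.borel_measurable_lebesgue_integral)
  then show ?thesis
    unfolding fourier_coeff_def by simp
qed

text \<open>Cauchy-Schwarz on each circle bounds the coefficient by the norm of the section divided
  by \<open>sqrt (2 * pi)\<close>; the squared section norms are integrable over the action by
  Fubini.\<close>

lemma fourier_coeff_L2:
  assumes "f \<in> L2 (phase_space a b)"
  shows "fourier_coeff f j \<in> L2 (action_space a b)"
proof -
  let ?s = "\<lambda>I. LINT z|circle_measure. (cmod (f (I, z)))\<^sup>2"
  have [measurable]: "f \<in> borel_measurable (phase_space a b)"
    using assms by (rule L2_measurable)
  have "integrable (action_space a b) (\<lambda>I. (cmod (fourier_coeff f j I))\<^sup>2)"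
  proof (rule Bochner_Integration.integrable_bound)
    show "integrable (action_space a b) ?s"
      using L2_integrable_square[OF assms] unfolding phase_space_def
      by (rule pair_sigma_finite.integrable_fst'[OF pair_sigma_finite_phase])
    show "AE I in action_space a b. norm ((cmod (fourier_coeff f j I))\<^sup>2) \<le> norm (?s I)"
      using AE_section_L2[OF assms]
    proof eventually_elim
      case (elim I)
      let ?n = "L2_norm circle_measure (\<lambda>z. f (I, z))"
      have "cmod (fourier_coeff f j I) \<le> sqrt (2 * pi) * ?n / (2 * pi)"
        using L2_Cauchy_Schwarz[OF powi_L2_circle elim, of j]
        by (simp add: fourier_coeff_inner norm_divide L2_norm_powi_circle divide_right_mono)
      also have "\<dots> = ?n / sqrt (2 * pi)"
        by (simp add: real_div_sqrt field_simps)
      also have "\<dots> \<le> ?n"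
      proof -
        have "?n * 1 \<le> ?n * sqrt (2 * pi)"
          using pi_gt3 by (intro mult_left_mono) auto
        then show ?thesis
          by (simp add: divide_le_eq)
      qed
      finally have "(cmod (fourier_coeff f j I))\<^sup>2 \<le> ?n\<^sup>2"
        by (rule power_mono) simp
      then show ?case
        by (simp add: L2_norm_square)
    qed
  qed measurable
  then show ?thesis
    by (simp add: L2_def)
qed

lemma fourier_coeff_add:
  assumes "f \<in> L2 (phase_space a b)" "g \<in> L2 (phase_space a b)"
  shows "AE I in action_space a b. \<forall>j. fourier_coeff (\<lambda>p. f p + g p) j I = fourier_coeff f j I + fourier_coeff g j I"
  using AE_section_integrable[OF assms(1)] AE_section_integrable[OF assms(2)]
  by eventually_elim (simp add: fourier_coeff_def distrib_right add_divide_distrib)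

lemma fourier_coeff_cmult: "fourier_coeff (\<lambda>p. c * f p) j I = c * fourier_coeff f j I"
  by (simp add: fourier_coeff_def mult.assoc)

lemma fourier_coeff_zero: "fourier_coeff (\<lambda>p. 0) j I = 0"
  by (simp add: fourier_coeff_def)

lemma fourier_coeff_diff:
  assumes "f \<in> L2 (phase_space a b)" "g \<in> L2 (phase_space a b)"
  shows "AE I in action_space a b. \<forall>j. fourier_coeff (\<lambda>p. f p - g p) j I = fourier_coeff f j I - fourier_coeff g j I"
  using AE_section_integrable[OF assms(1)] AE_section_integrable[OF assms(2)]
  by eventually_elim (simp add: fourier_coeff_def left_diff_distrib diff_divide_distrib)

lemma fourier_coeff_sum:
  assumes "finite X" "\<And>i. i \<in> X \<Longrightarrow> F i \<in> L2 (phase_space a b)"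
  shows "AE I in action_space a b. \<forall>j. fourier_coeff (\<lambda>p. \<Sum>i\<in>X. F i p) j I = (\<Sum>i\<in>X. fourier_coeff (F i) j I)"
  using assms
proof (induction X)
  case (insert i X)
  have "AE I in action_space a b. \<forall>j. fourier_coeff (\<lambda>p. F i p + (\<Sum>i\<in>X. F i p)) j I
      = fourier_coeff (F i) j I + fourier_coeff (\<lambda>p. \<Sum>i\<in>X. F i p) j I"
    using insert.prems by (intro fourier_coeff_add L2_sum) auto
  moreover have "AE I in action_space a b. \<forall>j. fourier_coeff (\<lambda>p. \<Sum>i\<in>X. F i p) j I = (\<Sum>i\<in>X. fourier_coeff (F i) j I)"
    using insert by auto
  ultimately show ?case
    by eventually_elim (simp add: insert.hyps)
qed (simp add: fourier_coeff_zero)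

text \<open>Outside one null set of actions all coefficients vanish together, so completeness of the
  characters applies section by section; Fubini turns this into a statement on the product.\<close>

lemma fourier_coeff_eq_0_AE:
  assumes "f \<in> L2 (phase_space a b)" "\<And>j. AE I in action_space a b. fourier_coeff f j I = 0"
  shows "AE x in phase_space a b. f x = 0"
proof -
  interpret pair_sigma_finite "action_space a b" circle_measure
    by (rule pair_sigma_finite_phase)
  have [measurable]: "f \<in> borel_measurable (phase_space a b)"
    using assms(1) by (rule L2_measurable)
  have "AE I in action_space a b. \<forall>j. fourier_coeff f j I = 0"
    using assms(2) by (simp add: AE_all_countable)
  with AE_section_integrable[OF assms(1)]
  have "AE I in action_space a b. AE z in circle_measure. f (I, z) = 0"
  proof eventually_elim
    case (elim I)
    show ?case
    proof (rule circle_characters_complete)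
      show "integrable circle_measure (\<lambda>z. f (I, z))"
        using elim(1)[rule_format, of 0] by simp
      fix j :: int
      \<comment> \<open>\<open>fourier_coeff\<close> pairs with conjugate characters, while
        completeness is stated for the characters themselves; on the circle the two differ by the
        sign of the index.\<close>
      have "(LINT z|circle_measure. f (I, z) * z powi j) = (LINT z|circle_measure. f (I, z) * cnj (z powi (- j)))"
        using powi_mult_cnj_circle[of _ 0] by (intro Bochner_Integration.integral_cong) simp_all
      also have "\<dots> = 0"
        using elim(2)[rule_format, of "- j"] by (simp add: fourier_coeff_def)
      finally show "(LINT z|circle_measure. f (I, z) * z powi j) = 0" .
    qed
  qed
  moreover have "{x \<in> space (action_space a b \<Otimes>\<^sub>M circle_measure). f x = 0} \<in> sets (action_space a b \<Otimes>\<^sub>M circle_measure)"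
    unfolding phase_space_def[symmetric] by measurable
  ultimately show ?thesis
    unfolding phase_space_def by (intro AE_pair_measure) auto
qed

lemma fourier_coeff_eq_AE:
  assumes "f \<in> L2 (phase_space a b)" "g \<in> L2 (phase_space a b)"
    and "\<And>j. AE I in action_space a b. fourier_coeff f j I = fourier_coeff g j I"
  shows "AE x in phase_space a b. f x = g x"
proof -
  have "AE x in phase_space a b. f x - g x = 0"
  proof (rule fourier_coeff_eq_0_AE[OF L2_diff[OF assms(1,2)]])
    show "AE I in action_space a b. fourier_coeff (\<lambda>x. f x - g x) j I = 0" for j
      using fourier_coeff_diff[OF assms(1,2)] assms(3)[of j] by eventually_elim simp
  qed
  then show ?thesis by simp
qed

lemma fourier_coeff_cong_AE:
  assumes "f \<in> L2 (phase_space a b)" "g \<in> L2 (phase_space a b)" "AE x in phase_space a b. f x = g x"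
  shows "AE I in action_space a b. \<forall>j. fourier_coeff f j I = fourier_coeff g j I"
  using AE_phase_section[OF assms(3)] AE_section_integrable[OF assms(1)] AE_section_integrable[OF assms(2)]
proof eventually_elim
  case (elim I)
  show ?case
  proof
    fix j
    have "(LINT z|circle_measure. f (I, z) * cnj (z powi j)) = (LINT z|circle_measure. g (I, z) * cnj (z powi j))"
    proof (rule integral_cong_AE)
      show "AE z in circle_measure. f (I, z) * cnj (z powi j) = g (I, z) * cnj (z powi j)"
        using elim(1) by eventually_elim simp
      show "(\<lambda>z. f (I, z) * cnj (z powi j)) \<in> borel_measurable circle_measure"
        using elim(2) by (blast dest: borel_measurable_integrable)
      show "(\<lambda>z. g (I, z) * cnj (z powi j)) \<in> borel_measurable circle_measure"
        using elim(3) by (blast dest: borel_measurable_integrable)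
    qed
    then show "fourier_coeff f j I = fourier_coeff g j I"
      by (simp add: fourier_coeff_def)
  qed
qed

subsection \<open>Fourier modes\<close>

text \<open>The common shape of \<open>fstar f\<close>, of the terms of the Fourier series and of
  \<open>spectral_term E f j\<close>, so that orthogonality and summation are treated once.\<close>

definition mode :: "(real \<Rightarrow> complex) \<Rightarrow> int \<Rightarrow> real \<times> complex \<Rightarrow> complex" where
  "mode c j = (\<lambda>(I, z). c I * z powi j)"

lemma fourier_coeff_mode: "fourier_coeff (mode c j) k I = (if j = k then c I else 0)"
proof -
  have "(LINT z|circle_measure. mode c j (I, z) * cnj (z powi k)) = (LINT z|circle_measure. c I * z powi (j - k))"
    by (intro Bochner_Integration.integral_cong)
       (simp_all add: mode_def mult.assoc powi_mult_cnj_circle del: complex_cnj_power_int)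
  then show ?thesis
    by (simp add: fourier_coeff_def integral_powi_circle)
qed

lemma mode_L2:
  assumes "c \<in> L2 (action_space a b)"
  shows "mode c j \<in> L2 (phase_space a b)"
proof -
  interpret pair_sigma_finite "action_space a b" circle_measure
    by (rule pair_sigma_finite_phase)
  have [measurable]: "c \<in> borel_measurable (action_space a b)"
    using assms by (rule L2_measurable)
  have meas[measurable]: "mode c j \<in> borel_measurable (phase_space a b)"
    unfolding mode_def case_prod_beta' by measurable
  have sec: "(LINT z|circle_measure. norm ((cmod (mode c j (I, z)))\<^sup>2)) = 2 * pi * (cmod (c I))\<^sup>2" for I
  proof -
    have "(LINT z|circle_measure. norm ((cmod (mode c j (I, z)))\<^sup>2)) = (LINT z|circle_measure. (cmod (c I))\<^sup>2)"
      by (intro Bochner_Integration.integral_cong) (simp_all add: mode_def norm_mult norm_powi_circle)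
    then show ?thesis
      by (simp add: measure_circle_space)
  qed
  have "integrable (action_space a b \<Otimes>\<^sub>M circle_measure) (\<lambda>x. (cmod (mode c j x))\<^sup>2)"
  proof (rule Fubini_integrable)
    show "(\<lambda>x. (cmod (mode c j x))\<^sup>2) \<in> borel_measurable (action_space a b \<Otimes>\<^sub>M circle_measure)"
      unfolding phase_space_def[symmetric] by measurable
    show "integrable (action_space a b) (\<lambda>I. LINT z|circle_measure. norm ((cmod (mode c j (I, z)))\<^sup>2))"
      unfolding sec using L2_integrable_square[OF assms] by (rule integrable_mult_right)
    have "integrable circle_measure (\<lambda>z. (cmod (mode c j (I, z)))\<^sup>2)" for I
      using L2_integrable_square[OF L2_cmult[OF powi_L2_circle, of "c I" j]] by (simp add: mode_def)
    then show "AE I in action_space a b. integrable circle_measure (\<lambda>z. (cmod (mode c j (I, z)))\<^sup>2)"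
      by simp
  qed
  with meas show ?thesis
    by (simp add: L2_def phase_space_def)
qed

text \<open>Fubini integrates over the circle first; the factor \<open>2 * pi\<close> undoes the
  normalisation in \<open>fourier_coeff\<close>. With a mode as second argument this gives
  orthogonality of distinct modes.\<close>

lemma L2_inner_mode:
  assumes "c \<in> L2 (action_space a b)" "f \<in> L2 (phase_space a b)"
  shows "L2_inner (phase_space a b) (mode c j) f = 2 * pi * L2_inner (action_space a b) c (fourier_coeff f j)"
proof -
  have "L2_inner (phase_space a b) (mode c j) f
      = (LINT I|action_space a b. (LINT z|circle_measure. cnj (mode c j (I, z)) * f (I, z)))"
    using pair_sigma_finite.integral_fst'[OF pair_sigma_finite_phase,
        OF L2_integrable_mult[OF mode_L2[OF assms(1)] assms(2), unfolded phase_space_def]]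
    by (simp add: L2_inner_def phase_space_def)
  also have "\<dots> = (LINT I|action_space a b. (2 * pi) * (cnj (c I) * fourier_coeff f j I))"
  proof (intro Bochner_Integration.integral_cong refl)
    fix I
    have "(LINT z|circle_measure. cnj (mode c j (I, z)) * f (I, z))
        = (LINT z|circle_measure. cnj (c I) * (f (I, z) * cnj (z powi j)))"
      by (intro Bochner_Integration.integral_cong refl) (simp add: mode_def algebra_simps)
    then show "(LINT z|circle_measure. cnj (mode c j (I, z)) * f (I, z)) = (2 * pi) * (cnj (c I) * fourier_coeff f j I)"
      by (simp add: fourier_coeff_def)
  qed
  finally show ?thesis
    by (simp add: L2_inner_def)
qed

lemma L2_norm_sum_mode:
  assumes "finite X" "\<And>j. j \<in> X \<Longrightarrow> c j \<in> L2 (action_space a b)"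
  shows "(L2_norm (phase_space a b) (\<lambda>x. \<Sum>j\<in>X. mode (c j) j x))\<^sup>2
       = (\<Sum>j\<in>X. 2 * pi * (L2_norm (action_space a b) (c j))\<^sup>2)"
proof -
  let ?S = "\<lambda>x. \<Sum>j\<in>X. mode (c j) j x"
  have S: "?S \<in> L2 (phase_space a b)"
    using assms by (intro L2_sum mode_L2)
  have "L2_inner (phase_space a b) ?S ?S = (\<Sum>j\<in>X. L2_inner (phase_space a b) (mode (c j) j) ?S)"
    using assms S by (intro L2_inner_sum_left mode_L2)
  also have "\<dots> = (\<Sum>j\<in>X. \<Sum>k\<in>X. L2_inner (phase_space a b) (mode (c j) j) (mode (c k) k))"
    using assms by (intro sum.cong refl L2_inner_sum_right mode_L2)
  also have "\<dots> = (\<Sum>j\<in>X. \<Sum>k\<in>X. if k = j then 2 * pi * L2_inner (action_space a b) (c j) (c j) else 0)"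
  proof (intro sum.cong refl)
    fix j k assume "j \<in> X" "k \<in> X"
    moreover have "L2_inner (action_space a b) (c j) (\<lambda>_. 0) = 0"
      by (simp add: L2_inner_def)
    ultimately show "L2_inner (phase_space a b) (mode (c j) j) (mode (c k) k)
        = (if k = j then 2 * pi * L2_inner (action_space a b) (c j) (c j) else 0)"
      using assms(2) by (auto simp: L2_inner_mode mode_L2 fourier_coeff_mode[abs_def])
  qed
  also have "\<dots> = of_real (\<Sum>j\<in>X. 2 * pi * (L2_norm (action_space a b) (c j))\<^sup>2)"
    using assms(1) by (simp add: L2_inner_self)
  finally show ?thesis
    unfolding L2_inner_self by (simp only: of_real_eq_iff)
qed

text \<open>The squared distance from \<open>f\<close> to its partial sum \<open>?S\<close> is
  \<open>norm^2 + ?m - 2 * ?m\<close>, as both the squared norm of \<open>?S\<close> and its pairing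
  with \<open>f\<close> equal \<open>?m\<close>; it cannot be negative.\<close>

lemma Bessel_inequality:
  assumes "finite X" "f \<in> L2 (phase_space a b)"
  shows "(\<Sum>j\<in>X. 2 * pi * (L2_norm (action_space a b) (fourier_coeff f j))\<^sup>2) \<le> (L2_norm (phase_space a b) f)\<^sup>2"
proof -
  let ?S = "\<lambda>x. \<Sum>j\<in>X. mode (fourier_coeff f j) j x"
  let ?m = "\<Sum>j\<in>X. 2 * pi * (L2_norm (action_space a b) (fourier_coeff f j))\<^sup>2"
  have S: "?S \<in> L2 (phase_space a b)"
    by (intro L2_sum mode_L2 fourier_coeff_L2 assms)
  have "L2_inner (phase_space a b) ?S f = (\<Sum>j\<in>X. L2_inner (phase_space a b) (mode (fourier_coeff f j) j) f)"
    by (intro L2_inner_sum_left mode_L2 fourier_coeff_L2 assms)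
  also have "\<dots> = of_real ?m"
    by (simp add: L2_inner_mode fourier_coeff_L2 assms L2_inner_self)
  finally have "L2_inner (phase_space a b) (\<lambda>x. - 1 * ?S x) f = - of_real ?m"
    by (simp add: L2_inner_def del: of_real_sum)
  then have "(L2_norm (phase_space a b) (\<lambda>x. f x + - 1 * ?S x))\<^sup>2 = (L2_norm (phase_space a b) f)\<^sup>2 + ?m - 2 * ?m"
    unfolding L2_norm_add_square[OF assms(2) L2_cmult[OF S]] L2_norm_cmult
    by (simp add: L2_norm_sum_mode assms fourier_coeff_L2 del: of_real_sum)
  moreover have "0 \<le> (L2_norm (phase_space a b) (\<lambda>x. f x + - 1 * ?S x))\<^sup>2"
    by (rule zero_le_power2)
  ultimately show ?thesis
    by linarith
qed

text \<open>Makes taking a coefficient continuous in \<open>L2\<close>, so coefficients pass through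
  \<open>L2\<close> limits. It is Bessel's inequality for one index, with
  \<open>2 * pi \<ge> 1\<close> dropped.\<close>

lemma L2_norm_fourier_coeff_le:
  assumes "f \<in> L2 (phase_space a b)"
  shows "L2_norm (action_space a b) (fourier_coeff f j) \<le> L2_norm (phase_space a b) f"
proof (rule power2_le_imp_le)
  have "1 * (L2_norm (action_space a b) (fourier_coeff f j))\<^sup>2 \<le> 2 * pi * (L2_norm (action_space a b) (fourier_coeff f j))\<^sup>2"
    using pi_gt3 by (intro mult_right_mono) auto
  also have "\<dots> \<le> (L2_norm (phase_space a b) f)\<^sup>2"
    using Bessel_inequality[of "{j}", OF _ assms] by simp
  finally show "(L2_norm (action_space a b) (fourier_coeff f j))\<^sup>2 \<le> (L2_norm (phase_space a b) f)\<^sup>2"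
    by simp
qed simp

text \<open>By orthogonality, sums over finite sets outside a large enough finite set are small.
  Riesz-Fischer needs a sequence, so finite sets \<open>X n\<close> with geometrically small tails
  are selected; their limit then attracts the whole net.\<close>

lemma L2_has_sum_mode_exists:
  assumes c: "\<And>j. j \<in> A \<Longrightarrow> c j \<in> L2 (action_space a b)"
    and sm: "(\<lambda>j. 2 * pi * (L2_norm (action_space a b) (c j))\<^sup>2) summable_on A"
  shows "\<exists>g. L2_has_sum (phase_space a b) (\<lambda>j. mode (c j) j) A g"
proof -
  let ?M = "phase_space a b"
  let ?m = "\<lambda>j. 2 * pi * (L2_norm (action_space a b) (c j))\<^sup>2"
  define S where "S X x = (\<Sum>j\<in>X. mode (c j) j x)" for X x
  have SL2: "S X \<in> L2 ?M" if "X \<subseteq> A" for X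
    unfolding S_def[abs_def] using that c by (intro L2_sum mode_L2) auto
  have normS: "(L2_norm ?M (S X))\<^sup>2 = sum ?m X" if "finite X" "X \<subseteq> A" for X
    unfolding S_def[abs_def] using that c by (intro L2_norm_sum_mode) auto
  \<comment> \<open>The selected sets need not be nested, so two partial sums differ by two pieces,
    one from each side of the symmetric difference.\<close>
  have diffS: "L2_norm ?M (\<lambda>x. S X x - S Y x) \<le> L2_norm ?M (S (X - Y)) + L2_norm ?M (S (Y - X))"
    if "finite X" "finite Y" "X \<subseteq> A" "Y \<subseteq> A" for X Y
  proof -
    have "S X x - S Y x = S (X - Y) x - S (Y - X) x" for x
      unfolding S_def using that
        sum.Int_Diff[of X "\<lambda>j. mode (c j) j x" Y] sum.Int_Diff[of Y "\<lambda>j. mode (c j) j x" X]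
      by (simp add: Int_commute)
    moreover have "L2_norm ?M (\<lambda>x. S (X - Y) x - S (Y - X) x) \<le> L2_norm ?M (S (X - Y)) + L2_norm ?M (S (Y - X))"
      using L2_norm_triangle[OF SL2 L2_cmult[OF SL2], of "X - Y" "Y - X" "-1"] that
        L2_norm_cmult[of ?M "-1"] by auto
    ultimately show ?thesis by simp
  qed
  have "\<exists>X. finite X \<and> X \<subseteq> A \<and> (\<forall>Z. finite Z \<longrightarrow> Z \<subseteq> A - X \<longrightarrow> L2_norm ?M (S Z) \<le> (1/2) ^ n / 2)" for n
  proof -
    \<comment> \<open>Half the squared tolerance: the sums over \<open>X\<close> and over
      \<open>X \<union> Z\<close> both lie within \<open>?e\<close> of the total, so the mass of
      \<open>Z\<close> is below \<open>2 * ?e\<close>.\<close>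
    let ?e = "((1/2) ^ n / 2)\<^sup>2 / 2 :: real"
    obtain s where s: "(?m has_sum s) A"
      using sm by (auto simp: summable_on_def)
    have "\<forall>\<^sub>F X in finite_subsets_at_top A. dist (sum ?m X) s < ?e"
      using s unfolding has_sum_def by (rule tendstoD) simp
    then obtain X where X: "finite X" "X \<subseteq> A"
      "\<And>Y. finite Y \<Longrightarrow> X \<subseteq> Y \<Longrightarrow> Y \<subseteq> A \<Longrightarrow> dist (sum ?m Y) s < ?e"
      unfolding eventually_finite_subsets_at_top by metis
    have "L2_norm ?M (S Z) \<le> (1/2) ^ n / 2" if Z: "finite Z" "Z \<subseteq> A - X" for Z
    proof (rule power2_le_imp_le)
      have "sum ?m (X \<union> Z) = sum ?m X + sum ?m Z"
        using X(1) Z by (intro sum.union_disjoint) auto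
      moreover have "dist (sum ?m (X \<union> Z)) s < ?e" "dist (sum ?m X) s < ?e"
        by (rule X(3); use X(1,2) Z in auto)+
      ultimately have "sum ?m Z \<le> ((1/2) ^ n / 2)\<^sup>2"
        unfolding dist_real_def by linarith
      then show "(L2_norm ?M (S Z))\<^sup>2 \<le> ((1/2) ^ n / 2)\<^sup>2"
        using Z by (subst normS) auto
    qed simp
    with X(1,2) show ?thesis by blast
  qed
  then obtain X where X: "\<And>n. finite (X n)" "\<And>n. X n \<subseteq> A"
    "\<And>n Z. finite Z \<Longrightarrow> Z \<subseteq> A - X n \<Longrightarrow> L2_norm ?M (S Z) \<le> (1/2) ^ n / 2"
    by metis
  have "L2_norm ?M (\<lambda>x. S (X (Suc n)) x - S (X n) x) \<le> (1/2) ^ n" for n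
  proof -
    \<comment> \<open>Each piece avoids one of the two sets, so the tail bounds for \<open>n\<close>
      and \<open>Suc n\<close> apply; \<open>1/2 + 1/4\<close> of \<open>(1/2) ^ n\<close> leaves
      room.\<close>
    have "L2_norm ?M (S (X (Suc n) - X n)) \<le> (1/2) ^ n / 2" "L2_norm ?M (S (X n - X (Suc n))) \<le> (1/2) ^ Suc n / 2"
      using X(1,2) by (intro X(3); blast)+
    moreover have "(1/2) ^ n / 2 + (1/2) ^ Suc n / 2 \<le> (1/2 :: real) ^ n"
      by simp
    ultimately show ?thesis
      using diffS[OF X(1)[of "Suc n"] X(1)[of n] X(2) X(2)] by linarith
  qed
  then obtain g where g: "g \<in> L2 ?M" "(\<lambda>n. L2_norm ?M (\<lambda>x. g x - S (X n) x)) \<longlonglongrightarrow> 0"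
    using finite_measure.L2_summable_increments_converge[OF finite_measure_phase, of "\<lambda>n. S (X n)" a b] SL2 X(2)
    by blast
  have "((\<lambda>Y. L2_norm ?M (\<lambda>x. g x - S Y x)) \<longlongrightarrow> 0) (finite_subsets_at_top A)"
  proof (rule tendstoI)
    fix e :: real assume "0 < e"
    have "(\<lambda>n. L2_norm ?M (\<lambda>x. g x - S (X n) x) + (1/2) ^ n / 2) \<longlonglongrightarrow> 0 + 0 / 2"
      by (intro tendsto_intros g LIMSEQ_power_zero) simp_all
    then have "\<forall>\<^sub>F n in sequentially. L2_norm ?M (\<lambda>x. g x - S (X n) x) + (1/2) ^ n / 2 < e"
      using \<open>0 < e\<close> by (intro order_tendstoD(2)) auto
    then obtain n where n: "L2_norm ?M (\<lambda>x. g x - S (X n) x) + (1/2) ^ n / 2 < e"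
      by (auto simp: eventually_sequentially)
    have "L2_norm ?M (\<lambda>x. g x - S Y x) < e" if Y: "finite Y" "X n \<subseteq> Y" "Y \<subseteq> A" for Y
    proof -
      have empty: "X n - Y = {}"
        using Y by auto
      have "L2_norm ?M (S (X n - Y)) = 0"
        unfolding empty by (simp add: S_def[abs_def] L2_norm_def)
      moreover have "L2_norm ?M (S (Y - X n)) \<le> (1/2) ^ n / 2"
        using Y by (intro X(3)) auto
      ultimately have "L2_norm ?M (\<lambda>x. S (X n) x - S Y x) \<le> (1/2) ^ n / 2"
        using diffS[of "X n" Y] X(1,2) Y by simp
      with L2_norm_triangle_diff[OF g(1) SL2[OF X(2)[of n]] SL2[OF Y(3)]] n show ?thesis
        by linarith
    qed
    then show "\<forall>\<^sub>F Y in finite_subsets_at_top A. dist (L2_norm ?M (\<lambda>x. g x - S Y x)) 0 < e"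
      unfolding eventually_finite_subsets_at_top using X(1,2)
      by (intro exI[of _ "X n"]) (auto simp: dist_real_def)
  qed
  with g(1) c show ?thesis
    unfolding L2_has_sum_def S_def by (auto intro: mode_L2)
qed

text \<open>The \<open>k\<close>-th coefficient of a partial sum no longer changes once the index
  set has absorbed \<open>k\<close>, and its distance to that of \<open>g\<close> is at most the
  \<open>L2\<close> distance, which tends to \<open>0\<close>.\<close>

lemma fourier_coeff_L2_has_sum:
  assumes c: "\<And>j. j \<in> A \<Longrightarrow> c j \<in> L2 (action_space a b)"
    and g: "L2_has_sum (phase_space a b) (\<lambda>j. mode (c j) j) A g"
  shows "AE I in action_space a b. fourier_coeff g k I = (if k \<in> A then c k I else 0)"
proof -
  let ?d = "\<lambda>I. fourier_coeff g k I - (if k \<in> A then c k I else 0)"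
  have gL2: "g \<in> L2 (phase_space a b)"
    and lim: "((\<lambda>X. L2_norm (phase_space a b) (\<lambda>x. g x - (\<Sum>j\<in>X. mode (c j) j x))) \<longlongrightarrow> 0) (finite_subsets_at_top A)"
    using g by (auto simp: L2_has_sum_def)
  have d: "?d \<in> L2 (action_space a b)"
    using c by (cases "k \<in> A") (auto intro!: L2_diff fourier_coeff_L2 gL2)
  have "L2_norm (action_space a b) ?d \<le> L2_norm (phase_space a b) (\<lambda>x. g x - (\<Sum>j\<in>X. mode (c j) j x))"
    \<comment> \<open>The intersection covers both cases: \<open>X\<close> must contain
      \<open>k\<close> if \<open>k\<close> is in \<open>A\<close>, and nothing is demanded
      otherwise.\<close>
    if X: "finite X" "{k} \<inter> A \<subseteq> X" "X \<subseteq> A" for X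
  proof -
    let ?S = "\<lambda>x. \<Sum>j\<in>X. mode (c j) j x"
    have m: "mode (c j) j \<in> L2 (phase_space a b)" if "j \<in> X" for j
      using that X c by (intro mode_L2) auto
    have S: "?S \<in> L2 (phase_space a b)"
      using m by (rule L2_sum)
    have "AE I in action_space a b. \<forall>i. fourier_coeff ?S i I = (\<Sum>j\<in>X. fourier_coeff (mode (c j) j) i I)"
      using X(1) m by (rule fourier_coeff_sum)
    with fourier_coeff_diff[OF gL2 S]
    have "AE I in action_space a b. fourier_coeff (\<lambda>x. g x - ?S x) k I = ?d I"
    proof eventually_elim
      case (elim I)
      then show ?case
        using X by (auto simp: fourier_coeff_mode)
    qed
    then have "L2_norm (action_space a b) ?d = L2_norm (action_space a b) (fourier_coeff (\<lambda>x. g x - ?S x) k)"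
      by (intro L2_norm_cong_AE[OF d fourier_coeff_L2[OF L2_diff[OF gL2 S]]]) auto
    also have "\<dots> \<le> L2_norm (phase_space a b) (\<lambda>x. g x - ?S x)"
      by (intro L2_norm_fourier_coeff_le L2_diff gL2 S)
    finally show ?thesis .
  qed
  then have "\<forall>\<^sub>F X in finite_subsets_at_top A.
      L2_norm (action_space a b) ?d \<le> L2_norm (phase_space a b) (\<lambda>x. g x - (\<Sum>j\<in>X. mode (c j) j x))"
    unfolding eventually_finite_subsets_at_top by (intro exI[of _ "{k} \<inter> A"]) auto
  then have "L2_norm (action_space a b) ?d \<le> 0"
    by (intro tendsto_lowerbound[OF lim]) auto
  then have "AE I in action_space a b. ?d I = 0"
    using d by (intro L2_norm_eq_0_AE) (auto intro: antisym)
  then show ?thesis by eventually_elim simp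
qed

section \<open>Fourier series and Parseval's identity\<close>

lemma fourier_series_summable:
  assumes "f \<in> L2 (phase_space a b)"
  shows "(\<lambda>j. 2 * pi * (L2_norm (action_space a b) (fourier_coeff f j))\<^sup>2) summable_on A"
  using Bessel_inequality[OF _ assms]
  by (intro nonneg_bdd_above_summable_on) (auto intro!: bdd_aboveI)

text \<open>The series has some sum \<open>g\<close> by Riesz-Fischer; \<open>g\<close> has the
  coefficients of \<open>f\<close>, so completeness identifies the two.\<close>

lemma fourier_series_L2_has_sum:
  assumes f: "f \<in> L2 (phase_space a b)"
  shows "L2_has_sum (phase_space a b) (\<lambda>j. mode (fourier_coeff f j) j) UNIV f"
proof -
  obtain g where g: "L2_has_sum (phase_space a b) (\<lambda>j. mode (fourier_coeff f j) j) UNIV g"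
    using L2_has_sum_mode_exists fourier_coeff_L2[OF f] fourier_series_summable[OF f] by blast
  have gL2: "g \<in> L2 (phase_space a b)"
    using g by (simp add: L2_has_sum_def)
  have eq: "AE x in phase_space a b. f x = g x"
  proof (rule fourier_coeff_eq_AE[OF f gL2])
    show "AE I in action_space a b. fourier_coeff f j I = fourier_coeff g j I" for j
      using fourier_coeff_L2_has_sum[OF fourier_coeff_L2[OF f] g, of j] by eventually_elim simp
  qed
  have "L2_norm (phase_space a b) (\<lambda>x. f x - (\<Sum>j\<in>X. mode (fourier_coeff f j) j x))
      = L2_norm (phase_space a b) (\<lambda>x. g x - (\<Sum>j\<in>X. mode (fourier_coeff f j) j x))" for X
    using eq by (intro L2_norm_cong_AE L2_diff L2_sum mode_L2 fourier_coeff_L2 f gL2) auto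
  with g f show ?thesis
    by (simp add: L2_has_sum_def)
qed

lemma Parseval_inner:
  assumes f: "f \<in> L2 (phase_space a b)" and g: "g \<in> L2 (phase_space a b)"
  shows "((\<lambda>j. 2 * pi * L2_inner (action_space a b) (fourier_coeff g j) (fourier_coeff f j))
     has_sum L2_inner (phase_space a b) g f) UNIV"
proof -
  let ?M = "phase_space a b"
  let ?S = "\<lambda>X x. \<Sum>j\<in>X. mode (fourier_coeff f j) j x"
  have S: "?S X \<in> L2 ?M" for X
    by (intro L2_sum mode_L2 fourier_coeff_L2 f)
  have inner: "L2_inner ?M g (?S X) = (\<Sum>j\<in>X. 2 * pi * L2_inner (action_space a b) (fourier_coeff g j) (fourier_coeff f j))" for X
  proof -
    have "L2_inner ?M g (?S X) = (\<Sum>j\<in>X. L2_inner ?M g (mode (fourier_coeff f j) j))"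
      by (intro L2_inner_sum_right mode_L2 fourier_coeff_L2 f g)
    also have "\<dots> = (\<Sum>j\<in>X. 2 * pi * L2_inner (action_space a b) (fourier_coeff g j) (fourier_coeff f j))"
    proof (intro sum.cong refl)
      fix j
      \<comment> \<open>\<open>L2_inner_mode\<close> has the mode in the conjugated slot, hence one
        conjugation here and one on the way back.\<close>
      have "L2_inner ?M g (mode (fourier_coeff f j) j) = cnj (L2_inner ?M (mode (fourier_coeff f j) j) g)"
        by (rule L2_inner_commute)
      also have "\<dots> = 2 * pi * cnj (L2_inner (action_space a b) (fourier_coeff f j) (fourier_coeff g j))"
        by (simp add: L2_inner_mode fourier_coeff_L2 f g)
      finally show "L2_inner ?M g (mode (fourier_coeff f j) j)
          = 2 * pi * L2_inner (action_space a b) (fourier_coeff g j) (fourier_coeff f j)"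
        by (simp only: L2_inner_commute[of _ "fourier_coeff g j"])
    qed
    finally show ?thesis .
  qed
  have "((\<lambda>X. L2_norm ?M g * L2_norm ?M (\<lambda>x. f x - ?S X x)) \<longlongrightarrow> L2_norm ?M g * 0) (finite_subsets_at_top UNIV)"
    using fourier_series_L2_has_sum[OF f] unfolding L2_has_sum_def by (intro tendsto_mult tendsto_const) auto
  moreover have "cmod (L2_inner ?M g f - L2_inner ?M g (?S X)) \<le> L2_norm ?M g * L2_norm ?M (\<lambda>x. f x - ?S X x)" for X
    using L2_Cauchy_Schwarz[OF g L2_diff[OF f S]] unfolding L2_inner_diff_right[OF g f S] .
  ultimately have "((\<lambda>X. L2_inner ?M g f - L2_inner ?M g (?S X)) \<longlongrightarrow> 0) (finite_subsets_at_top UNIV)"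
    unfolding mult_zero_right
    by (rule Lim_null_comparison[OF always_eventually, OF allI, rotated])
  then have "((\<lambda>X. L2_inner ?M g f - (L2_inner ?M g f - L2_inner ?M g (?S X))) \<longlongrightarrow> L2_inner ?M g f - 0) (finite_subsets_at_top UNIV)"
    by (rule tendsto_diff[OF tendsto_const])
  then show ?thesis
    unfolding has_sum_def by (simp only: diff_diff_eq2 add_diff_cancel_left' diff_zero inner)
qed

lemma Parseval_norm:
  assumes f: "f \<in> L2 (phase_space a b)"
  shows "((\<lambda>j. 2 * pi * (L2_norm (action_space a b) (fourier_coeff f j))\<^sup>2)
     has_sum (L2_norm (phase_space a b) f)\<^sup>2) UNIV"
proof -
  have "((\<lambda>j. of_real (2 * pi * (L2_norm (action_space a b) (fourier_coeff f j))\<^sup>2) :: complex)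
     has_sum of_real ((L2_norm (phase_space a b) f)\<^sup>2)) UNIV"
    using Parseval_inner[OF f f] by (simp add: L2_inner_self)
  then show ?thesis
    by (simp only: has_sum_of_real_iff)
qed

text \<open>The boundedness principle for multipliers: \<open>K = 1\<close> gives contractivity of
  \<open>P(E)\<close>, and a small \<open>K\<close> the convergence of the spectral
  integral.\<close>

lemma L2_norm_le_of_fourier_coeff_le:
  assumes f: "f \<in> L2 (phase_space a b)" and h: "h \<in> L2 (phase_space a b)" and "0 \<le> K"
    and le: "\<And>j. AE I in action_space a b. cmod (fourier_coeff h j I) \<le> K * cmod (fourier_coeff f j I)"
  shows "L2_norm (phase_space a b) h \<le> K * L2_norm (phase_space a b) f"
proof (rule power2_le_imp_le)
  have "(L2_norm (action_space a b) (fourier_coeff h j))\<^sup>2 \<le> K\<^sup>2 * (L2_norm (action_space a b) (fourier_coeff f j))\<^sup>2" for j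
  proof -
    have "(LINT I|action_space a b. (cmod (fourier_coeff h j I))\<^sup>2) \<le> (LINT I|action_space a b. K\<^sup>2 * (cmod (fourier_coeff f j I))\<^sup>2)"
    proof (intro integral_mono_AE integrable_mult_right L2_integrable_square fourier_coeff_L2 f h)
      show "AE I in action_space a b. (cmod (fourier_coeff h j I))\<^sup>2 \<le> K\<^sup>2 * (cmod (fourier_coeff f j I))\<^sup>2"
        using le[of j] by eventually_elim (metis power_mono power_mult_distrib norm_ge_zero)
    qed
    then show ?thesis
      by (simp add: L2_norm_square)
  qed
  then have "2 * pi * (L2_norm (action_space a b) (fourier_coeff h j))\<^sup>2 \<le> K\<^sup>2 * (2 * pi * (L2_norm (action_space a b) (fourier_coeff f j))\<^sup>2)" for j
    using mult_left_mono[of _ _ "2 * pi"] by (simp add: mult.left_commute)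
  then have "(L2_norm (phase_space a b) h)\<^sup>2 \<le> K\<^sup>2 * (L2_norm (phase_space a b) f)\<^sup>2"
    by (intro has_sum_mono[OF Parseval_norm[OF h] has_sum_cmult_right[OF Parseval_norm[OF f]]])
  then show "(L2_norm (phase_space a b) h)\<^sup>2 \<le> (K * L2_norm (phase_space a b) f)\<^sup>2"
    by (simp add: power_mult_distrib)
qed (use \<open>0 \<le> K\<close> in simp)

section \<open>Time averages\<close>

lemma has_bochner_integral_circle:
  fixes F :: "complex \<Rightarrow> 'a::{banach, second_countable_topology}"
  assumes "integrable circle_measure F"
  shows "has_bochner_integral lborel (\<lambda>\<theta>. indicator {0..<2*pi} \<theta> *\<^sub>R F (cis \<theta>)) (LINT z|circle_measure. F z)"
proof -
  let ?R = "restrict_space lborel {0..<2*pi}"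
  have F: "F \<in> borel_measurable (restrict_space borel (sphere 0 1))"
    using borel_measurable_integrable[OF assms] by (simp add: measurable_cong_sets[OF sets_circle refl])
  have "integrable ?R (\<lambda>\<theta>. F (cis \<theta>))"
    using assms unfolding circle_measure_def by (rule integrable_distr[OF measurable_cis_circle_restrict])
  moreover have "(LINT z|circle_measure. F z) = (LINT \<theta>|?R. F (cis \<theta>))"
    unfolding circle_measure_def by (rule integral_distr[OF measurable_cis_circle_restrict F])
  ultimately show ?thesis
    by (simp add: has_bochner_integral_iff integrable_restrict_space integral_restrict_space)
qed

text \<open>The substitution \<open>t = T + \<theta> / \<omega>\<close> turns one period of the
  orbit into one turn of the circle, and rotation invariance absorbs the starting angle
  \<open>s\<close>.\<close>

lemma has_bochner_integral_orbit_period: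
  fixes F :: "complex \<Rightarrow> 'a::{banach, second_countable_topology}"
  assumes F: "integrable circle_measure F" and "0 < \<omega>" and z: "z \<in> sphere 0 1"
  shows "has_bochner_integral lborel (\<lambda>t. indicator {T..<T + 2 * pi / \<omega>} t *\<^sub>R F (z * cis (\<omega> * t)))
    ((LINT w|circle_measure. F w) /\<^sub>R \<omega>)"
proof -
  obtain \<alpha> where \<alpha>: "z = cis \<alpha>"
    using z by (metis cis_Arg_unique complex_norm_eq_1_exp_eq cis_conv_exp mem_sphere_0)
  define s where "s = \<alpha> + \<omega> * T"
  have "has_bochner_integral lborel (\<lambda>\<theta>. indicator {0..<2*pi} \<theta> *\<^sub>R F (cis \<theta> * cis s)) (LINT w|circle_measure. F w)"
    using has_bochner_integral_circle[OF integrable_circle_rotate[OF F, of s]]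
    unfolding integral_circle_rotate[OF borel_measurable_integrable[OF F]] .
  moreover have "indicator {0..<2*pi} \<theta> *\<^sub>R F (cis \<theta> * cis s)
      = indicator {T..<T + 2 * pi / \<omega>} (T + 1 / \<omega> * \<theta>) *\<^sub>R F (z * cis (\<omega> * (T + 1 / \<omega> * \<theta>)))" for \<theta>
  proof -
    have "z * cis (\<omega> * (T + 1 / \<omega> * \<theta>)) = cis \<theta> * cis s"
      using \<open>0 < \<omega>\<close> by (simp add: \<alpha> s_def cis_mult algebra_simps)
    moreover have "T + 1 / \<omega> * \<theta> \<in> {T..<T + 2 * pi / \<omega>} \<longleftrightarrow> \<theta> \<in> {0..<2*pi}"
      using \<open>0 < \<omega>\<close> by (auto simp: field_simps)
    ultimately show ?thesis
      by (simp add: indicator_def)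
  qed
  ultimately show ?thesis
    using \<open>0 < \<omega>\<close>
    by (subst lborel_has_bochner_integral_real_affine_iff[where c = "1 / \<omega>" and t = T]) simp_all
qed

lemma rotation_time_average:
  fixes F :: "complex \<Rightarrow> complex"
  assumes F: "integrable circle_measure F" and \<omega>: "0 < \<omega>" and z: "z \<in> sphere 0 1"
  shows "((\<lambda>T. (LBINT t:{0..T}. F (z * cis (\<omega> * t))) /\<^sub>R T) \<longlongrightarrow> (LINT w|circle_measure. F w) / (2 * pi)) at_top"
proof -
  define h where "h t = F (z * cis (\<omega> * t))" for t
  define p where "p = 2 * pi / \<omega>"
  define m where "m = (LINT w|circle_measure. F w) / (2 * pi)"
  define K where "K = (LINT w|circle_measure. cmod (F w)) / \<omega>"
  have p: "0 < p"
    using \<omega> by (simp add: p_def)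
  have per: "set_integrable lborel {T..<T + p} h" "(LBINT t:{T..<T + p}. h t) = of_real p * m" for T
  proof -
    have "(LINT w|circle_measure. F w) /\<^sub>R \<omega> = of_real p * m"
      using \<omega> by (simp add: p_def m_def scaleR_conv_of_real field_simps)
    then show "set_integrable lborel {T..<T + p} h" "(LBINT t:{T..<T + p}. h t) = of_real p * m"
      using has_bochner_integral_orbit_period[OF F \<omega> z, of T]
      by (simp_all add: set_integrable_def set_lebesgue_integral_def has_bochner_integral_iff h_def p_def)
  qed
  have perK: "(LBINT t:{T..<T + p}. cmod (h t)) = K" for T
    using has_bochner_integral_orbit_period[OF integrable_norm[OF F] \<omega> z, of T]
    by (simp add: set_lebesgue_integral_def has_bochner_integral_iff h_def p_def K_def field_simps)
  have whole: "set_integrable lborel {0..<real n * p} h \<and> (LBINT t:{0..<real n * p}. h t) = of_real (real n * p) * m" for n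
  proof (induction n)
    case 0
    show ?case by (simp add: set_integrable_def set_lebesgue_integral_def)
  next
    case (Suc n)
    have "{0..<q + p} = {0..<q} \<union> {q..<q + p}" if "0 \<le> q" for q
      using that p by auto
    moreover have "0 \<le> real n * p" "real (Suc n) * p = real n * p + p"
      using p by (simp_all add: algebra_simps)
    ultimately have "{0..<real (Suc n) * p} = {0..<real n * p} \<union> {real n * p..<real n * p + p}"
      by simp
    then show ?case
      using Suc per[of "real n * p"]
      by (simp add: set_integral_Un set_integrable_Un algebra_simps)
  qed
  \<comment> \<open>The whole periods in \<open>{0..T}\<close> contribute their mean exactly. What
    is left is shorter than \<open>p\<close>: \<open>K\<close> bounds its integral and
    \<open>p * cmod m\<close> its share of the mean.\<close>
  have est: "cmod ((LBINT t:{0..T}. h t) - of_real T * m) \<le> K + p * cmod m" if "0 < T" for T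
  proof -
    define n where "n = nat \<lfloor>T / p\<rfloor>"
    have n: "real n * p \<le> T" "T < real n * p + p"
    proof -
      have "real n = of_int \<lfloor>T / p\<rfloor>"
        using that p by (simp add: n_def)
      then have "real n \<le> T / p" "T / p < real n + 1"
        by linarith+
      then show "real n * p \<le> T" "T < real n * p + p"
        using p by (simp_all add: field_simps)
    qed
    let ?J = "{real n * p..T}"
    have sub: "?J \<subseteq> {real n * p..<real n * p + p}"
      using n by auto
    have J: "set_integrable lborel ?J h"
      by (rule set_integrable_subset[OF per(1) _ sub]) simp
    have "{0..T} = {0..<q} \<union> {q..T}" if "0 \<le> q" "q \<le> T" for q
      using that by auto
    then have "{0..T} = {0..<real n * p} \<union> ?J"
      using n(1) p by simp
    moreover have "{0..<real n * p} \<inter> ?J = {}"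
      by auto
    ultimately have "(LBINT t:{0..T}. h t) = of_real (real n * p) * m + (LBINT t:?J. h t)"
      using whole[of n] J by (simp only: set_integral_Un)
    then have "(LBINT t:{0..T}. h t) - of_real T * m = (LBINT t:?J. h t) - of_real (T - real n * p) * m"
      by (simp add: algebra_simps)
    also have "cmod \<dots> \<le> cmod (LBINT t:?J. h t) + cmod (of_real (T - real n * p) * m)"
      by (rule norm_triangle_ineq4)
    also have "\<dots> \<le> K + p * cmod m"
    proof (rule add_mono)
      have "cmod (LBINT t:?J. h t) \<le> (LBINT t:?J. cmod (h t))"
        using J by (rule set_integral_norm_bound)
      \<comment> \<open>\<open>F\<close> is only integrable, so the remainder has no uniform
        pointwise bound; extending it to a full period gives a bound independent of
        \<open>T\<close>.\<close>
      also have "\<dots> \<le> (LBINT t:{real n * p..<real n * p + p}. cmod (h t))"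
        unfolding set_lebesgue_integral_def
        using set_integrable_norm[OF J] set_integrable_norm[OF per(1)] sub
        by (intro integral_mono) (auto simp: set_integrable_def indicator_def)
      finally show "cmod (LBINT t:?J. h t) \<le> K"
        by (simp only: perK)
      show "cmod (of_real (T - real n * p) * m) \<le> p * cmod m"
        unfolding norm_mult norm_of_real using n by (intro mult_right_mono) auto
    qed
    finally show ?thesis .
  qed
  have "((\<lambda>T. (K + p * cmod m) / T) \<longlongrightarrow> 0) at_top"
    by (rule real_tendsto_divide_at_top[OF tendsto_const filterlim_ident])
  moreover have "\<forall>\<^sub>F T in at_top. cmod ((LBINT t:{0..T}. h t) /\<^sub>R T - m) \<le> (K + p * cmod m) / T"
    using eventually_gt_at_top[of 0]
  proof eventually_elim
    case (elim T)
    have "(LBINT t:{0..T}. h t) /\<^sub>R T - m = ((LBINT t:{0..T}. h t) - of_real T * m) /\<^sub>R T"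
      using elim by (simp add: scaleR_conv_of_real field_simps)
    then show ?case
      using est[OF elim] elim by (simp add: divide_inverse mult.commute mult_right_mono)
  qed
  ultimately have "((\<lambda>T. (LBINT t:{0..T}. h t) /\<^sub>R T - m) \<longlongrightarrow> 0) at_top"
    by (rule Lim_null_comparison[rotated])
  then show ?thesis
    unfolding h_def m_def by (rule LIM_zero_cancel)
qed

text \<open>Over a good action the average exists at every angle. The actions discarded are
  \<open>I = 0\<close>, where the flow is at rest, and those with a non-integrable section.\<close>

lemma has_time_average_fstar:
  assumes "0 \<le> a" and f: "f \<in> L2 (phase_space a b)"
  shows "AE x in phase_space a b. has_time_average f x (fstar f x)"
proof -
  have "AE I in action_space a b. I \<noteq> 0"
    using AE_lborel_singleton[of "0::real"] by (auto simp: AE_restrict_space_iff elim: eventually_mono)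
  then have "AE x in phase_space a b. fst x \<noteq> 0"
    by (rule AE_phase_fst)
  moreover have "AE x in phase_space a b. \<forall>j::int. integrable circle_measure (\<lambda>z. f (fst x, z) * cnj (z powi j))"
    by (rule AE_phase_fst[OF AE_section_integrable[OF f]])
  ultimately show ?thesis
    using AE_space
  proof eventually_elim
    case (elim x)
    obtain I z where x: "x = (I, z)" by fastforce
    have "integrable circle_measure (\<lambda>z. f (I, z))"
      using elim(2)[rule_format, of 0] by (simp add: x)
    moreover have "0 < I" "z \<in> sphere 0 1"
      using elim(1,3) \<open>0 \<le> a\<close> by (auto simp: x space_phase)
    ultimately show ?case
      using rotation_time_average[of "\<lambda>z. f (I, z)" I z]
      by (simp add: has_time_average_def x koopman_def fstar_def fourier_coeff_def)
  qed
qed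

section \<open>The Koopman operator\<close>

text \<open>On each circle the flow is a rotation by the fixed angle \<open>I * t\<close>, so
  section norms are unchanged and Fubini gives square integrability.\<close>

lemma koopman_L2:
  assumes f: "f \<in> L2 (phase_space a b)"
  shows "koopman t f \<in> L2 (phase_space a b)"
proof -
  interpret pair_sigma_finite "action_space a b" circle_measure
    by (rule pair_sigma_finite_phase)
  have [measurable]: "f \<in> borel_measurable (phase_space a b)"
    using f by (rule L2_measurable)
  have [measurable]: "cis \<in> borel_measurable borel"
    by (intro borel_measurable_continuous_onI continuous_on_cis continuous_on_id)
  have "(\<lambda>x. snd x * cis (fst x * t)) \<in> phase_space a b \<rightarrow>\<^sub>M restrict_space borel (sphere 0 1)"
    by (intro measurable_restrict_space2) (auto simp: space_phase norm_mult)
  then have "(\<lambda>x. snd x * cis (fst x * t)) \<in> phase_space a b \<rightarrow>\<^sub>M circle_measure"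
    by (simp add: measurable_cong_sets[OF refl sets_circle])
  then have [measurable]: "(\<lambda>x. (fst x, snd x * cis (fst x * t))) \<in> phase_space a b \<rightarrow>\<^sub>M phase_space a b"
    unfolding phase_space_def[of a b] by (intro measurable_Pair) simp_all
  have "(\<lambda>x. f (fst x, snd x * cis (fst x * t))) \<in> borel_measurable (phase_space a b)"
    by measurable
  then have meas[measurable]: "koopman t f \<in> borel_measurable (phase_space a b)"
    by (simp add: koopman_def case_prod_beta')
  have "integrable (action_space a b \<Otimes>\<^sub>M circle_measure) (\<lambda>x. (cmod (koopman t f x))\<^sup>2)"
  proof (rule Fubini_integrable)
    show "(\<lambda>x. (cmod (koopman t f x))\<^sup>2) \<in> borel_measurable (action_space a b \<Otimes>\<^sub>M circle_measure)"
      unfolding phase_space_def[symmetric] by measurable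
    have "(LINT z|circle_measure. (cmod (f (I, z * cis (I * t))))\<^sup>2) = (LINT z|circle_measure. (cmod (f (I, z)))\<^sup>2)"
      if I: "I \<in> space (action_space a b)" for I
      using phase_section_measurable[of f a b I] I
      by (intro integral_circle_rotate[of "\<lambda>z. (cmod (f (I, z)))\<^sup>2"]) simp
    moreover have "integrable (action_space a b) (\<lambda>I. LINT z|circle_measure. (cmod (f (I, z)))\<^sup>2)"
      using L2_integrable_square[OF f] unfolding phase_space_def by (rule integrable_fst')
    ultimately show "integrable (action_space a b) (\<lambda>I. LINT z|circle_measure. norm ((cmod (koopman t f (I, z)))\<^sup>2))"
      by (subst Bochner_Integration.integrable_cong[OF refl]) (simp_all add: koopman_def)
    show "AE I in action_space a b. integrable circle_measure (\<lambda>z. (cmod (koopman t f (I, z)))\<^sup>2)"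
      using AE_section_L2[OF f]
    proof eventually_elim
      case (elim I)
      then show ?case
        using integrable_circle_rotate[OF L2_integrable_square[OF elim], of "I * t"] by (simp add: koopman_def)
    qed
  qed
  with meas show ?thesis
    by (simp add: L2_def phase_space_def)
qed

lemma fourier_coeff_koopman:
  assumes f: "f \<in> borel_measurable (phase_space a b)" and I: "I \<in> {a..b}"
  shows "fourier_coeff (koopman t f) j I = cis (of_int j * I * t) * fourier_coeff f j I"
proof -
  let ?w = "cis (I * t)"
  let ?G = "\<lambda>z. f (I, z) * cnj (z powi j)"
  have [measurable]: "(\<lambda>z. f (I, z)) \<in> borel_measurable circle_measure"
    by (rule phase_section_measurable[OF f I])
  \<comment> \<open>Inserting this unit factor makes the integrand a constant times a function of
    the rotated point.\<close>
  have "?w powi j * cnj (?w powi j) = 1"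
    using powi_mult_cnj_circle[of ?w j j] by simp
  then have "koopman t f (I, z) * cnj (z powi j) = ?w powi j * ?G (z * ?w)" for z
    by (simp add: koopman_def power_int_mult_distrib algebra_simps)
  then have "(LINT z|circle_measure. koopman t f (I, z) * cnj (z powi j))
      = ?w powi j * (LINT z|circle_measure. ?G (z * ?w))"
    by simp
  also have "(LINT z|circle_measure. ?G (z * ?w)) = (LINT z|circle_measure. ?G z)"
    by (rule integral_circle_rotate) measurable
  finally show ?thesis
    by (simp add: fourier_coeff_def cis_powi mult.assoc)
qed

section \<open>The spectral projections\<close>

lemma fstar_eq_mode: "fstar f = mode (fourier_coeff f 0) 0"
  by (simp add: fstar_def mode_def)

lemma fstar_L2: "f \<in> L2 (phase_space a b) \<Longrightarrow> fstar f \<in> L2 (phase_space a b)"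
  unfolding fstar_eq_mode by (intro mode_L2 fourier_coeff_L2)

lemma zero_mean_iff:
  "f \<in> zero_mean a b \<longleftrightarrow> f \<in> L2 (phase_space a b) \<and> (AE I in action_space a b. fourier_coeff f 0 I = 0)"
proof (intro iffI conjI; (elim conjE)?)
  assume f: "f \<in> zero_mean a b"
  then show L: "f \<in> L2 (phase_space a b)"
    by (simp add: zero_mean_def)
  from f have "AE x in phase_space a b. fstar f x = 0"
    by (simp add: zero_mean_def)
  from fourier_coeff_cong_AE[OF fstar_L2[OF L] L2_zero this]
  show "AE I in action_space a b. fourier_coeff f 0 I = 0"
    by eventually_elim (auto simp: fstar_eq_mode fourier_coeff_mode fourier_coeff_zero dest: spec[of _ 0])
next
  assume f: "f \<in> L2 (phase_space a b)" "AE I in action_space a b. fourier_coeff f 0 I = 0"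
  have "AE x in phase_space a b. fstar f x = 0"
    using AE_phase_fst[OF f(2)] by eventually_elim (simp add: fstar_def case_prod_beta')
  with f show "f \<in> zero_mean a b"
    by (simp add: zero_mean_def)
qed

definition spectral_coeff :: "real set \<Rightarrow> (real \<times> complex \<Rightarrow> complex) \<Rightarrow> int \<Rightarrow> real \<Rightarrow> complex" where
  "spectral_coeff E f j I = indicator E (of_int j * I) * fourier_coeff f j I"

lemma spectral_term_eq_mode: "spectral_term E f j = mode (spectral_coeff E f j) j"
  by (simp add: spectral_term_def mode_def spectral_coeff_def)

lemma spectral_coeff_le: "cmod (spectral_coeff E f j I) \<le> cmod (fourier_coeff f j I)"
  by (simp add: spectral_coeff_def norm_mult indicator_def)

lemma spectral_coeff_L2:
  assumes [measurable]: "E \<in> sets borel" and f: "f \<in> L2 (phase_space a b)"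
  shows "spectral_coeff E f j \<in> L2 (action_space a b)"
proof (rule L2_dominated[OF fourier_coeff_L2[OF f]])
  have [measurable]: "f \<in> borel_measurable (phase_space a b)"
    using f by (rule L2_measurable)
  have [measurable]: "(\<lambda>I. indicator E (of_int j * I) :: complex) \<in> borel_measurable (action_space a b)"
    by measurable
  show "spectral_coeff E f j \<in> borel_measurable (action_space a b)"
    unfolding spectral_coeff_def[abs_def] by measurable
  show "AE I in action_space a b. cmod (spectral_coeff E f j I) \<le> 1 * cmod (fourier_coeff f j I)"
    by (simp add: spectral_coeff_le)
qed

lemma L2_norm_spectral_coeff_le:
  assumes "E \<in> sets borel" and f: "f \<in> L2 (phase_space a b)"
  shows "(L2_norm (action_space a b) (spectral_coeff E f j))\<^sup>2 \<le> (L2_norm (action_space a b) (fourier_coeff f j))\<^sup>2"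
  unfolding L2_norm_square
  by (intro integral_mono L2_integrable_square spectral_coeff_L2 fourier_coeff_L2 assms power_mono spectral_coeff_le norm_ge_zero)

text \<open>Justifies the choice behind \<open>spectral_proj\<close>: the coefficients cut down to
  \<open>E\<close> are dominated by those of \<open>f\<close>, so a sum exists.\<close>

lemma spectral_proj_L2_has_sum:
  assumes "E \<in> sets borel" and f: "f \<in> L2 (phase_space a b)"
  shows "L2_has_sum (phase_space a b) (spectral_term E f) (- {0}) (spectral_proj a b E f)"
proof -
  have "(\<lambda>j. 2 * pi * (L2_norm (action_space a b) (spectral_coeff E f j))\<^sup>2) summable_on - {0}"
    by (rule summable_on_comparison_test[OF fourier_series_summable[OF f]])
       (use L2_norm_spectral_coeff_le[OF assms] in auto)
  then have "\<exists>g. L2_has_sum (phase_space a b) (spectral_term E f) (- {0}) g"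
    unfolding spectral_term_eq_mode[abs_def] using spectral_coeff_L2[OF assms]
    by (intro L2_has_sum_mode_exists)
  then show ?thesis
    unfolding spectral_proj_def L2_infsum_def by (rule someI_ex)
qed

lemma spectral_proj_L2:
  "E \<in> sets borel \<Longrightarrow> f \<in> L2 (phase_space a b) \<Longrightarrow> spectral_proj a b E f \<in> L2 (phase_space a b)"
  using spectral_proj_L2_has_sum[of E f a b] by (simp add: L2_has_sum_def)

text \<open>The working description of \<open>P(E)\<close> as a multiplier. Having all
  \<open>j\<close> under one almost-everywhere quantifier lets later proofs combine several such
  facts pointwise.\<close>

lemma fourier_coeff_spectral_proj:
  assumes "E \<in> sets borel" and f: "f \<in> L2 (phase_space a b)"
  shows "AE I in action_space a b.
    \<forall>j. fourier_coeff (spectral_proj a b E f) j I = (if j = 0 then 0 else indicator E (of_int j * I) * fourier_coeff f j I)"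
proof -
  have "AE I in action_space a b.
      fourier_coeff (spectral_proj a b E f) j I = (if j \<in> - {0} then spectral_coeff E f j I else 0)" for j
    using spectral_coeff_L2[OF assms] spectral_proj_L2_has_sum[OF assms]
    unfolding spectral_term_eq_mode[abs_def] by (rule fourier_coeff_L2_has_sum)
  then have "AE I in action_space a b. \<forall>j.
      fourier_coeff (spectral_proj a b E f) j I = (if j \<in> - {0} then spectral_coeff E f j I else 0)"
    by (simp add: AE_all_countable)
  then show ?thesis
    by eventually_elim (auto simp: spectral_coeff_def)
qed

lemma spectral_proj_zero_mean:
  "E \<in> sets borel \<Longrightarrow> f \<in> L2 (phase_space a b) \<Longrightarrow> spectral_proj a b E f \<in> zero_mean a b"
  using fourier_coeff_spectral_proj[of E f a b]
  by (auto simp: zero_mean_iff spectral_proj_L2 elim: eventually_mono)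

section \<open>Projection properties read off from the multipliers\<close>

lemma spectral_proj_cong_AE:
  assumes E: "E \<in> sets borel" and f: "f \<in> L2 (phase_space a b)" and g: "g \<in> L2 (phase_space a b)"
    and eq: "AE x in phase_space a b. f x = g x"
  shows "AE x in phase_space a b. spectral_proj a b E f x = spectral_proj a b E g x"
proof (rule fourier_coeff_eq_AE[OF spectral_proj_L2[OF E f] spectral_proj_L2[OF E g]])
  show "AE I in action_space a b. fourier_coeff (spectral_proj a b E f) j I = fourier_coeff (spectral_proj a b E g) j I" for j
    using fourier_coeff_spectral_proj[OF E f] fourier_coeff_spectral_proj[OF E g] fourier_coeff_cong_AE[OF f g eq]
    by eventually_elim simp
qed

lemma spectral_proj_add:
  assumes E: "E \<in> sets borel" and f: "f \<in> L2 (phase_space a b)" and g: "g \<in> L2 (phase_space a b)"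
  shows "AE x in phase_space a b.
    spectral_proj a b E (\<lambda>y. f y + g y) x = spectral_proj a b E f x + spectral_proj a b E g x"
proof (rule fourier_coeff_eq_AE)
  note Ef = spectral_proj_L2[OF E f] and Eg = spectral_proj_L2[OF E g]
  show "spectral_proj a b E (\<lambda>y. f y + g y) \<in> L2 (phase_space a b)"
    by (intro spectral_proj_L2 E L2_add f g)
  show "(\<lambda>x. spectral_proj a b E f x + spectral_proj a b E g x) \<in> L2 (phase_space a b)"
    by (intro L2_add Ef Eg)
  show "AE I in action_space a b. fourier_coeff (spectral_proj a b E (\<lambda>y. f y + g y)) j I
      = fourier_coeff (\<lambda>x. spectral_proj a b E f x + spectral_proj a b E g x) j I" for j
    using fourier_coeff_spectral_proj[OF E L2_add[OF f g]] fourier_coeff_spectral_proj[OF E f]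
      fourier_coeff_spectral_proj[OF E g] fourier_coeff_add[OF f g] fourier_coeff_add[OF Ef Eg]
    by eventually_elim (simp add: distrib_left)
qed

lemma spectral_proj_cmult:
  assumes E: "E \<in> sets borel" and f: "f \<in> L2 (phase_space a b)"
  shows "AE x in phase_space a b. spectral_proj a b E (\<lambda>y. c * f y) x = c * spectral_proj a b E f x"
proof (rule fourier_coeff_eq_AE)
  show "spectral_proj a b E (\<lambda>y. c * f y) \<in> L2 (phase_space a b)"
    by (intro spectral_proj_L2 E L2_cmult f)
  show "(\<lambda>x. c * spectral_proj a b E f x) \<in> L2 (phase_space a b)"
    by (intro L2_cmult spectral_proj_L2 E f)
  show "AE I in action_space a b. fourier_coeff (spectral_proj a b E (\<lambda>y. c * f y)) j I
      = fourier_coeff (\<lambda>x. c * spectral_proj a b E f x) j I" for j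
    using fourier_coeff_spectral_proj[OF E L2_cmult[OF f, where c = c]] fourier_coeff_spectral_proj[OF E f]
    by eventually_elim (simp add: fourier_coeff_cmult)
qed

lemma L2_norm_spectral_proj_le:
  assumes E: "E \<in> sets borel" and f: "f \<in> L2 (phase_space a b)"
  shows "L2_norm (phase_space a b) (spectral_proj a b E f) \<le> L2_norm (phase_space a b) f"
proof -
  have "L2_norm (phase_space a b) (spectral_proj a b E f) \<le> 1 * L2_norm (phase_space a b) f"
  proof (rule L2_norm_le_of_fourier_coeff_le[OF f spectral_proj_L2[OF E f]])
    show "AE I in action_space a b. cmod (fourier_coeff (spectral_proj a b E f) j I) \<le> 1 * cmod (fourier_coeff f j I)" for j
      using fourier_coeff_spectral_proj[OF E f]
      by eventually_elim (simp add: norm_mult indicator_def)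
  qed simp
  then show ?thesis by simp
qed

lemma spectral_proj_Int:
  assumes E: "E \<in> sets borel" and F: "F \<in> sets borel" and f: "f \<in> L2 (phase_space a b)"
  shows "AE x in phase_space a b. spectral_proj a b (E \<inter> F) f x = spectral_proj a b E (spectral_proj a b F f) x"
proof -
  have EF: "E \<inter> F \<in> sets borel"
    using E F by simp
  note Ff = spectral_proj_L2[OF F f]
  show ?thesis
  proof (rule fourier_coeff_eq_AE[OF spectral_proj_L2[OF EF f] spectral_proj_L2[OF E Ff]])
    show "AE I in action_space a b. fourier_coeff (spectral_proj a b (E \<inter> F) f) j I
        = fourier_coeff (spectral_proj a b E (spectral_proj a b F f)) j I" for j
      using fourier_coeff_spectral_proj[OF EF f] fourier_coeff_spectral_proj[OF E Ff] fourier_coeff_spectral_proj[OF F f]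
      by eventually_elim (simp add: indicator_inter_arith)
  qed
qed

text \<open>The multiplier is real, so it moves across the conjugation in each term of the two
  Parseval sums.\<close>

lemma spectral_proj_self_adjoint:
  assumes E: "E \<in> sets borel" and f: "f \<in> L2 (phase_space a b)" and g: "g \<in> L2 (phase_space a b)"
  shows "L2_inner (phase_space a b) g (spectral_proj a b E f) = L2_inner (phase_space a b) (spectral_proj a b E g) f"
proof -
  note Ef = spectral_proj_L2[OF E f] and Eg = spectral_proj_L2[OF E g]
  have "L2_inner (action_space a b) (fourier_coeff g j) (fourier_coeff (spectral_proj a b E f) j)
      = L2_inner (action_space a b) (fourier_coeff (spectral_proj a b E g) j) (fourier_coeff f j)" for j
    unfolding L2_inner_def
  proof (rule integral_cong_AE)
    show "AE I in action_space a b. cnj (fourier_coeff g j I) * fourier_coeff (spectral_proj a b E f) j I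
        = cnj (fourier_coeff (spectral_proj a b E g) j I) * fourier_coeff f j I"
      using fourier_coeff_spectral_proj[OF E f] fourier_coeff_spectral_proj[OF E g]
      by eventually_elim (simp add: indicator_def)
  qed (use L2_integrable_mult[OF fourier_coeff_L2[OF g] fourier_coeff_L2[OF Ef]]
        L2_integrable_mult[OF fourier_coeff_L2[OF Eg] fourier_coeff_L2[OF f]] in \<open>blast dest: borel_measurable_integrable\<close>)+
  with Parseval_inner[OF Ef g] Parseval_inner[OF f Eg] show ?thesis
    by (simp add: has_sum_unique)
qed

lemma spectral_proj_orthogonal_projection:
  assumes E: "E \<in> sets borel"
  shows "orthogonal_projection_on (phase_space a b) (zero_mean a b) (spectral_proj a b E)"
proof -
  have L: "f \<in> L2 (phase_space a b)" if "f \<in> zero_mean a b" for f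
    using that by (simp add: zero_mean_def)
  have "AE x in phase_space a b. spectral_proj a b E (spectral_proj a b E f) x = spectral_proj a b E f x"
    if "f \<in> L2 (phase_space a b)" for f
    using spectral_proj_Int[OF E E that] by eventually_elim simp
  moreover have "\<exists>C. \<forall>f\<in>zero_mean a b. L2_norm (phase_space a b) (spectral_proj a b E f) \<le> C * L2_norm (phase_space a b) f"
    using L2_norm_spectral_proj_le[OF E] L by (intro exI[of _ 1]) simp
  ultimately show ?thesis
    unfolding orthogonal_projection_on_def
    using L E by (intro conjI ballI impI allI)
      (blast intro: spectral_proj_zero_mean spectral_proj_cong_AE spectral_proj_add spectral_proj_cmult
        spectral_proj_self_adjoint)+
qed

text \<open>Dominated convergence for unordered sums: outside a finite \<open>X\<close> the sum of
  \<open>m n\<close> is at most that of \<open>w\<close>, which is small, and on \<open>X\<close>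
  there are finitely many null sequences.\<close>

lemma has_sum_dominated_tendsto_0:
  fixes m :: "nat \<Rightarrow> 'i \<Rightarrow> real"
  assumes w: "(w has_sum s) A" and m: "\<And>n. (m n has_sum S n) A"
    and nonneg: "\<And>n j. j \<in> A \<Longrightarrow> 0 \<le> m n j" and le: "\<And>n j. j \<in> A \<Longrightarrow> m n j \<le> w j"
    and lim: "\<And>j. j \<in> A \<Longrightarrow> (\<lambda>n. m n j) \<longlonglongrightarrow> 0"
  shows "S \<longlonglongrightarrow> 0"
proof (rule tendstoI)
  fix e :: real assume "0 < e"
  then have "\<forall>\<^sub>F X in finite_subsets_at_top A. dist (sum w X) s < e / 2"
    using w unfolding has_sum_def by (intro tendstoD) auto
  then obtain X where X: "finite X" "X \<subseteq> A" "dist (sum w X) s < e / 2"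
    unfolding eventually_finite_subsets_at_top by blast
  have "(\<lambda>n. \<Sum>j\<in>X. m n j) \<longlonglongrightarrow> (\<Sum>j\<in>X. 0)"
    using X(2) lim by (intro tendsto_sum) auto
  then have "\<forall>\<^sub>F n in sequentially. (\<Sum>j\<in>X. m n j) < e / 2"
    using \<open>0 < e\<close> by (intro order_tendstoD(2)) auto
  then show "\<forall>\<^sub>F n in sequentially. dist (S n) 0 < e"
  proof eventually_elim
    case (elim n)
    have "((\<lambda>j. w j - m n j) has_sum s - S n) A"
      using has_sum_add[OF w, of "\<lambda>j. - m n j" "- S n"] m[of n] by (simp add: has_sum_uminus)
    \<comment> \<open>Nonnegativity of \<open>w - m n\<close> yields the tail estimate; rearranged,
      \<open>S n\<close> is at most \<open>s - sum w X\<close> plus the sum of \<open>m n\<close>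
      over \<open>X\<close>, each below \<open>e / 2\<close>.\<close>
    then have "(\<Sum>j\<in>X. w j - m n j) \<le> s - S n"
      using X le by (intro finite_sum_le_has_sum) auto
    moreover have "0 \<le> S n"
      using m nonneg by (rule has_sum_nonneg)
    ultimately show ?case
      using elim X(3) unfolding sum_subtractf dist_real_def diff_0_right by linarith
  qed
qed

lemma spectral_proj_countably_additive:
  fixes A :: "nat \<Rightarrow> real set"
  assumes A: "range A \<subseteq> sets borel" "disjoint_family A" and f: "f \<in> L2 (phase_space a b)"
  shows "(\<lambda>N. L2_norm (phase_space a b) (\<lambda>x. spectral_proj a b (\<Union>n. A n) f x - (\<Sum>n<N. spectral_proj a b (A n) f x)))
    \<longlonglongrightarrow> 0"
proof -
  let ?M = "phase_space a b"
  \<comment> \<open>The tail unions: the remainder after \<open>N\<close> terms has the coefficients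
    of \<open>P(B N) f\<close>, and by disjointness every real number eventually leaves
    \<open>B N\<close>.\<close>
  define B where "B N = (\<Union>n\<in>{N..}. A n)" for N
  define h where "h N = (\<lambda>x. spectral_proj a b (\<Union>n. A n) f x - (\<Sum>n<N. spectral_proj a b (A n) f x))" for N
  have An: "A n \<in> sets borel" for n
    using A(1) by auto
  have U: "(\<Union>n. A n) \<in> sets borel"
    using An by auto
  have B: "B N \<in> sets borel" for N
    unfolding B_def using An by auto
  have split: "indicator (\<Union>n. A n) x = (\<Sum>n<N. indicator (A n) x) + (indicator (B N) x :: complex)" for x N
  proof -
    have "(\<Sum>n<N. indicator (A n) x) = (indicator (\<Union>n<N. A n) x :: complex)"
      using A(2) by (intro indicator_UN_disjoint[symmetric]) (auto simp: disjoint_family_on_def)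
    moreover have "(\<Union>n. A n) = (\<Union>n<N. A n) \<union> B N"
    proof -
      have "UNIV = {..<N} \<union> {N..}"
        by auto
      then show ?thesis
        unfolding B_def by (metis UN_Un)
    qed
    moreover have "(\<Union>n<N. A n) \<inter> B N = {}"
    proof -
      have "A m \<inter> A n = {}" if "m < N" "N \<le> n" for m n
        using A(2) that by (simp add: disjoint_family_on_def)
      then show ?thesis
        unfolding B_def by blast
    qed
    ultimately show ?thesis
      by (auto simp: indicator_def)
  qed
  have PA: "(\<lambda>x. \<Sum>n<N. spectral_proj a b (A n) f x) \<in> L2 ?M" for N
    by (intro L2_sum spectral_proj_L2 An f)
  have h: "h N \<in> L2 ?M" for N
    unfolding h_def by (intro L2_diff spectral_proj_L2 U f PA)
  have coeff: "AE I in action_space a b. \<forall>j. fourier_coeff (h N) j I = (if j = 0 then 0 else spectral_coeff (B N) f j I)" for N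
  proof -
    have "AE I in action_space a b. \<forall>n j. fourier_coeff (spectral_proj a b (A n) f) j I
        = (if j = 0 then 0 else indicator (A n) (of_int j * I) * fourier_coeff f j I)"
      unfolding AE_all_countable[where P = "\<lambda>n I. \<forall>j. fourier_coeff (spectral_proj a b (A n) f) j I
        = (if j = 0 then 0 else indicator (A n) (of_int j * I) * fourier_coeff f j I)"]
      using fourier_coeff_spectral_proj[OF An f] by (rule allI)
    moreover have "AE I in action_space a b. \<forall>j. fourier_coeff (\<lambda>x. \<Sum>n<N. spectral_proj a b (A n) f x) j I
        = (\<Sum>n<N. fourier_coeff (spectral_proj a b (A n) f) j I)"
      by (intro fourier_coeff_sum spectral_proj_L2 An f) auto
    ultimately show ?thesis
      using fourier_coeff_diff[OF spectral_proj_L2[OF U f] PA[of N]] fourier_coeff_spectral_proj[OF U f]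
    proof eventually_elim
      case (elim I)
      then show ?case
        by (simp add: h_def split[of _ N] spectral_coeff_def distrib_right sum_distrib_right)
    qed
  qed
  have norm_coeff: "(L2_norm (action_space a b) (fourier_coeff (h N) j))\<^sup>2
      = (if j = 0 then 0 else (L2_norm (action_space a b) (spectral_coeff (B N) f j))\<^sup>2)" for N j
  proof -
    have "L2_norm (action_space a b) (fourier_coeff (h N) j)
        = L2_norm (action_space a b) (\<lambda>I. if j = 0 then 0 else spectral_coeff (B N) f j I)"
    proof (rule L2_norm_cong_AE[OF fourier_coeff_L2[OF h]])
      show "(\<lambda>I. if j = 0 then 0 else spectral_coeff (B N) f j I) \<in> L2 (action_space a b)"
        using spectral_coeff_L2[OF B f] by (cases "j = 0") simp_all
      show "AE I in action_space a b. fourier_coeff (h N) j I = (if j = 0 then 0 else spectral_coeff (B N) f j I)"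
        using coeff[of N] by eventually_elim simp
    qed
    then show ?thesis
      by (cases "j = 0") (simp_all add: L2_norm_def)
  qed
  \<comment> \<open>Dominated convergence is used twice: in the action for each fixed index, then
    over the indices.\<close>
  have "(\<lambda>N. (L2_norm ?M (h N))\<^sup>2) \<longlonglongrightarrow> 0"
  proof (rule has_sum_dominated_tendsto_0[OF Parseval_norm[OF f] Parseval_norm[OF h]])
    fix j N
    show "2 * pi * (L2_norm (action_space a b) (fourier_coeff (h N) j))\<^sup>2
        \<le> 2 * pi * (L2_norm (action_space a b) (fourier_coeff f j))\<^sup>2"
      using L2_norm_spectral_coeff_le[OF B f] by (simp add: norm_coeff)
  next
    fix j :: int
    have "(\<lambda>N. (L2_norm (action_space a b) (spectral_coeff (B N) f j))\<^sup>2) \<longlonglongrightarrow> (LINT I|action_space a b. 0)"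
      unfolding L2_norm_square
    proof (rule integral_dominated_convergence)
      show "integrable (action_space a b) (\<lambda>I. (cmod (fourier_coeff f j I))\<^sup>2)"
        by (intro L2_integrable_square fourier_coeff_L2 f)
      show "(\<lambda>I. (cmod (spectral_coeff (B N) f j I))\<^sup>2) \<in> borel_measurable (action_space a b)" for N
        by (intro borel_measurable_integrable L2_integrable_square spectral_coeff_L2 B f)
      show "AE I in action_space a b. norm ((cmod (spectral_coeff (B N) f j I))\<^sup>2) \<le> (cmod (fourier_coeff f j I))\<^sup>2" for N
        by (simp add: spectral_coeff_le power_mono)
      show "AE I in action_space a b. (\<lambda>N. (cmod (spectral_coeff (B N) f j I))\<^sup>2) \<longlonglongrightarrow> 0"
      proof (rule AE_I2)
        fix I
        have "\<exists>k. \<forall>N\<ge>k. of_int j * I \<notin> B N"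
        proof (cases "\<exists>k. of_int j * I \<in> A k")
          case True
          then obtain k where "of_int j * I \<in> A k" by blast
          then have "of_int j * I \<notin> A n" if "n \<noteq> k" for n
            using A(2) that unfolding disjoint_family_on_def by blast
          then show ?thesis
            by (intro exI[of _ "Suc k"]) (auto simp: B_def)
        qed (auto simp: B_def)
        then have "\<forall>\<^sub>F N in sequentially. of_int j * I \<notin> B N"
          by (simp add: eventually_sequentially)
        then have "\<forall>\<^sub>F N in sequentially. (cmod (spectral_coeff (B N) f j I))\<^sup>2 = 0"
          by eventually_elim (simp add: spectral_coeff_def)
        then show "(\<lambda>N. (cmod (spectral_coeff (B N) f j I))\<^sup>2) \<longlonglongrightarrow> 0"
          by (rule tendsto_eventually)
      qed
    qed simp
    then show "(\<lambda>N. 2 * pi * (L2_norm (action_space a b) (fourier_coeff (h N) j))\<^sup>2) \<longlonglongrightarrow> 0"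
      unfolding norm_coeff by (cases "j = 0") (auto intro: tendsto_mult_right_zero)
  qed simp
  then have "(\<lambda>N. sqrt ((L2_norm ?M (h N))\<^sup>2)) \<longlonglongrightarrow> sqrt 0"
    by (rule tendsto_real_sqrt)
  then show ?thesis
    by (simp add: h_def)
qed

lemma spectral_proj_empty:
  assumes f: "f \<in> L2 (phase_space a b)"
  shows "AE x in phase_space a b. spectral_proj a b {} f x = 0"
proof (rule fourier_coeff_eq_0_AE[OF spectral_proj_L2[OF _ f]])
  show "AE I in action_space a b. fourier_coeff (spectral_proj a b {} f) j I = 0" for j
    using fourier_coeff_spectral_proj[OF sets.empty_sets f] by eventually_elim simp
qed simp

lemma spectral_proj_UNIV:
  assumes f: "f \<in> zero_mean a b"
  shows "AE x in phase_space a b. spectral_proj a b UNIV f x = f x"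
proof -
  have L: "f \<in> L2 (phase_space a b)" and z: "AE I in action_space a b. fourier_coeff f 0 I = 0"
    using f by (simp_all add: zero_mean_iff)
  have univ: "UNIV \<in> sets (borel :: real measure)"
    by simp
  show ?thesis
  proof (rule fourier_coeff_eq_AE[OF spectral_proj_L2[OF univ L] L])
    show "AE I in action_space a b. fourier_coeff (spectral_proj a b UNIV f) j I = fourier_coeff f j I" for j
      using fourier_coeff_spectral_proj[OF univ L] z by eventually_elim simp
  qed
qed

lemma spectral_proj_projection_valued_measure:
  "projection_valued_measure (phase_space a b) (zero_mean a b) (spectral_proj a b)"
proof -
  have L: "f \<in> L2 (phase_space a b)" if "f \<in> zero_mean a b" for f
    using that by (simp add: zero_mean_def)
  show ?thesis
    unfolding projection_valued_measure_def
    using spectral_proj_countably_additive[OF _ _ L]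
    by (intro conjI ballI allI impI spectral_proj_orthogonal_projection spectral_proj_empty
        spectral_proj_UNIV spectral_proj_Int L)
qed

section \<open>Scalar spectral measures\<close>

lemma spectral_measure_complex_measure:
  assumes f: "f \<in> L2 (phase_space a b)" and g: "g \<in> L2 (phase_space a b)"
  shows "complex_measure lborel (\<lambda>E. L2_inner (phase_space a b) g (spectral_proj a b E f))"
  unfolding complex_measure_def
proof (intro allI impI)
  fix A :: "nat \<Rightarrow> real set"
  assume "range A \<subseteq> sets lborel" and disj: "disjoint_family A"
  then have A: "range A \<subseteq> sets borel"
    by simp
  let ?M = "phase_space a b"
  let ?P = "\<lambda>E. spectral_proj a b E f"
  have An: "?P (A n) \<in> L2 ?M" for n
    using A by (intro spectral_proj_L2 f) auto
  have S: "(\<lambda>x. \<Sum>n<N. ?P (A n) x) \<in> L2 ?M" for N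
    by (intro L2_sum An)
  have U: "?P (\<Union>n. A n) \<in> L2 ?M"
    using A by (intro spectral_proj_L2 f) auto
  have "(\<lambda>N. L2_norm ?M g * L2_norm ?M (\<lambda>x. ?P (\<Union>n. A n) x - (\<Sum>n<N. ?P (A n) x))) \<longlonglongrightarrow> 0"
    by (rule tendsto_mult_right_zero[OF spectral_proj_countably_additive[OF A disj f]])
  moreover have "cmod (L2_inner ?M g (?P (\<Union>n. A n)) - (\<Sum>n<N. L2_inner ?M g (?P (A n))))
      \<le> L2_norm ?M g * L2_norm ?M (\<lambda>x. ?P (\<Union>n. A n) x - (\<Sum>n<N. ?P (A n) x))" for N
    using L2_Cauchy_Schwarz[OF g L2_diff[OF U S[of N]]]
    unfolding L2_inner_diff_right[OF g U S] L2_inner_sum_right[OF g An] .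
  ultimately have "(\<lambda>N. L2_inner ?M g (?P (\<Union>n. A n)) - (\<Sum>n<N. L2_inner ?M g (?P (A n)))) \<longlonglongrightarrow> 0"
    by (rule Lim_null_comparison[OF always_eventually, OF allI, rotated])
  from tendsto_diff[OF tendsto_const[of "L2_inner ?M g (?P (\<Union>n. A n))"] this]
  show "(\<lambda>n. L2_inner ?M g (?P (A n))) sums L2_inner ?M g (?P (\<Union>n. A n))"
    unfolding sums_def by (simp only: diff_diff_eq2 add_diff_cancel_left' diff_zero)
qed

lemma spectral_measure_absolutely_continuous:
  assumes f: "f \<in> L2 (phase_space a b)"
  shows "complex_absolutely_continuous lborel (\<lambda>E. L2_inner (phase_space a b) g (spectral_proj a b E f))"
  unfolding complex_absolutely_continuous_def
proof
  fix E :: "real set" assume null: "E \<in> null_sets lborel"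
  then have E: "E \<in> sets borel"
    by (auto dest: null_setsD2)
  have "AE I in action_space a b. fourier_coeff (spectral_proj a b E f) j I = 0" for j
  proof (cases "j = 0")
    case False
    have "AE x in lborel. x \<notin> E"
      using null by (rule AE_not_in)
    \<comment> \<open>Affine maps with nonzero slope pull null sets back to null sets; slope
      \<open>j = 0\<close> is harmless because that mode is absent from
      \<open>P(E) f\<close>.\<close>
    then have "AE x in lborel. 0 + of_int j * x \<notin> E"
      using False E by (intro AE_borel_affine) auto
    then have "AE I in action_space a b. of_int j * I \<notin> E"
      by (auto simp: AE_restrict_space_iff elim: eventually_mono)
    with fourier_coeff_spectral_proj[OF E f] show ?thesis
      by eventually_elim simp
  qed (use fourier_coeff_spectral_proj[OF E f] in \<open>auto elim: eventually_mono\<close>)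
  then have "AE x in phase_space a b. spectral_proj a b E f x = 0"
    by (rule fourier_coeff_eq_0_AE[OF spectral_proj_L2[OF E f]])
  then show "L2_inner (phase_space a b) g (spectral_proj a b E f) = 0"
    unfolding L2_inner_def by (intro integral_eq_zero_AE) (auto elim: eventually_mono)
qed

section \<open>The spectral resolution of the Koopman operator\<close>

lemma fourier_coeff_simple_spectral_integral:
  assumes s: "simple_function borel s" and f: "f \<in> L2 (phase_space a b)"
  shows "simple_spectral_integral (spectral_proj a b) s f \<in> L2 (phase_space a b)"
    and "AE I in action_space a b. \<forall>j. fourier_coeff (simple_spectral_integral (spectral_proj a b) s f) j I
      = (if j = 0 then 0 else s (of_int j * I) * fourier_coeff f j I)"
proof -
  have fin: "finite (range s)"
    using simple_functionD(1)[OF s] by simp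
  have meas: "s -` {c} \<in> sets borel" for c
    using simple_functionD(2)[OF s, of "{c}"] by simp
  have summand: "(\<lambda>x. c * spectral_proj a b (s -` {c}) f x) \<in> L2 (phase_space a b)" for c
    by (intro L2_cmult spectral_proj_L2 meas f)
  show "simple_spectral_integral (spectral_proj a b) s f \<in> L2 (phase_space a b)"
    unfolding simple_spectral_integral_def by (intro L2_sum summand)
  have "AE I in action_space a b. \<forall>c\<in>range s. \<forall>j. fourier_coeff (spectral_proj a b (s -` {c}) f) j I
      = (if j = 0 then 0 else indicator (s -` {c}) (of_int j * I) * fourier_coeff f j I)"
    by (intro AE_finite_allI fin fourier_coeff_spectral_proj meas f)
  moreover have "AE I in action_space a b. \<forall>j. fourier_coeff (\<lambda>x. \<Sum>c\<in>range s. c * spectral_proj a b (s -` {c}) f x) j I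
      = (\<Sum>c\<in>range s. fourier_coeff (\<lambda>x. c * spectral_proj a b (s -` {c}) f x) j I)"
    by (intro fourier_coeff_sum fin summand)
  ultimately show "AE I in action_space a b. \<forall>j. fourier_coeff (simple_spectral_integral (spectral_proj a b) s f) j I
      = (if j = 0 then 0 else s (of_int j * I) * fourier_coeff f j I)"
  proof eventually_elim
    case (elim I)
    \<comment> \<open>For given \<open>x\<close> exactly one value \<open>c\<close> in the range,
      namely \<open>s x\<close>, has \<open>x\<close> in its fibre.\<close>
    have "(\<Sum>c\<in>range s. c * (indicator (s -` {c}) x * w)) = s x * w" for x and w :: complex
    proof -
      have "(\<Sum>c\<in>range s. c * (indicator (s -` {c}) x * w)) = (\<Sum>c\<in>range s. if s x = c then c * w else 0)"
        by (intro sum.cong) (auto simp: indicator_def)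
      then show ?thesis
        using fin by simp
    qed
    moreover have "(\<Sum>c\<in>range s. c * fourier_coeff (spectral_proj a b (s -` {c}) f) j I)
        = (\<Sum>c\<in>range s. c * (if j = 0 then 0 else indicator (s -` {c}) (of_int j * I) * fourier_coeff f j I))" for j
    proof (intro sum.cong refl)
      fix c assume "c \<in> range s"
      from elim(1)[rule_format, OF this, of j]
      show "c * fourier_coeff (spectral_proj a b (s -` {c}) f) j I
          = c * (if j = 0 then 0 else indicator (s -` {c}) (of_int j * I) * fourier_coeff f j I)"
        by (simp only:)
    qed
    ultimately show ?case
      using elim(2) by (simp add: simple_spectral_integral_def fourier_coeff_cmult)
  qed
qed

text \<open>The integral of a simple \<open>s\<close> acts as the multiplier
  \<open>s (j * I)\<close>, so its distance to the candidate \<open>?u\<close> is at most the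
  uniform distance of \<open>s\<close> to \<open>?\<phi>\<close> times the norm of \<open>f\<close>,
  for any approximating sequence.\<close>

lemma koopman_has_spectral_integral:
  assumes f: "f \<in> L2 (phase_space a b)"
  shows "has_spectral_integral (phase_space a b) (spectral_proj a b)
    (\<lambda>\<beta>. exp (\<i> * of_real \<beta> * of_real t)) f (\<lambda>x. koopman t f x - fstar f x)"
proof -
  let ?M = "phase_space a b"
  let ?\<phi> = "\<lambda>\<beta>::real. exp (\<i> * of_real \<beta> * of_real t)"
  let ?u = "\<lambda>x. koopman t f x - fstar f x"
  have \<phi>: "?\<phi> \<beta> = cis (\<beta> * t)" for \<beta>
    by (simp add: cis_conv_exp mult.assoc)
  have u: "?u \<in> L2 ?M"
    by (intro L2_diff koopman_L2 fstar_L2 f)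
  have "AE I in action_space a b. I \<in> {a..b}"
    using AE_space[of "action_space a b"] by simp
  \<comment> \<open>At \<open>j = 0\<close> the Koopman factor is \<open>1\<close> and
    \<open>fstar\<close> cancels the coefficient; at every other index \<open>fstar\<close>
    contributes nothing.\<close>
  then have u_coeff: "AE I in action_space a b. \<forall>j. fourier_coeff ?u j I
      = (if j = 0 then 0 else ?\<phi> (of_int j * I) * fourier_coeff f j I)"
    using fourier_coeff_diff[OF koopman_L2[OF f] fstar_L2[OF f], of t]
  proof eventually_elim
    case (elim I)
    then show ?case
      unfolding \<phi> by (simp add: fourier_coeff_koopman[OF L2_measurable[OF f]] fstar_eq_mode fourier_coeff_mode)
  qed
  have "(\<lambda>n. L2_norm ?M (\<lambda>x. ?u x - simple_spectral_integral (spectral_proj a b) (s n) f x)) \<longlonglongrightarrow> 0"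
    if simple: "\<And>n. simple_function borel (s n)" and lim: "uniform_limit UNIV s ?\<phi> sequentially"
    for s :: "nat \<Rightarrow> real \<Rightarrow> complex"
  proof (rule tendstoI)
    fix e :: real assume "0 < e"
    let ?K = "L2_norm ?M f"
    \<comment> \<open>Uniform closeness \<open>d\<close> gives \<open>L2\<close> closeness
      \<open>d * ?K < e\<close>; the \<open>+ 1\<close> covers \<open>?K = 0\<close>.\<close>
    define d where "d = e / (?K + 1)"
    have K: "0 < ?K + 1"
      by (rule add_nonneg_pos) simp_all
    have d: "0 < d"
      using \<open>0 < e\<close> K by (simp add: d_def)
    have "\<forall>\<^sub>F n in sequentially. \<forall>x\<in>UNIV. dist (s n x) (?\<phi> x) < d"
      using lim d by (rule uniform_limitD)
    then show "\<forall>\<^sub>F n in sequentially.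
        dist (L2_norm ?M (\<lambda>x. ?u x - simple_spectral_integral (spectral_proj a b) (s n) f x)) 0 < e"
    proof eventually_elim
      case (elim n)
      note S = fourier_coeff_simple_spectral_integral[OF simple[of n] f]
      have "L2_norm ?M (\<lambda>x. ?u x - simple_spectral_integral (spectral_proj a b) (s n) f x) \<le> d * ?K"
      proof (rule L2_norm_le_of_fourier_coeff_le[OF f L2_diff[OF u S(1)]])
        fix j
        show "AE I in action_space a b.
            cmod (fourier_coeff (\<lambda>x. ?u x - simple_spectral_integral (spectral_proj a b) (s n) f x) j I)
            \<le> d * cmod (fourier_coeff f j I)"
          using fourier_coeff_diff[OF u S(1)] u_coeff S(2)
        proof eventually_elim
          case coeffs: (elim I)
          show ?case
          proof (cases "j = 0")
            case False
            have "cmod (?\<phi> (of_int j * I) - s n (of_int j * I)) \<le> d"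
              using elim by (metis UNIV_I dist_commute dist_norm less_imp_le)
            then have "cmod ((?\<phi> (of_int j * I) - s n (of_int j * I)) * fourier_coeff f j I) \<le> d * cmod (fourier_coeff f j I)"
              unfolding norm_mult by (rule mult_right_mono) simp
            with False coeffs show ?thesis
              by (simp only: left_diff_distrib if_False)
          qed (use coeffs d in simp)
        qed
      qed (use d in simp)
      also have "\<dots> < d * (?K + 1)"
        using d by simp
      also have "\<dots> = e"
        using K by (simp add: d_def)
      finally show ?case
        by (simp add: dist_real_def)
    qed
  qed
  moreover have "?\<phi> \<in> borel_measurable borel"
    by (intro borel_measurable_continuous_onI continuous_intros)
  moreover have "bounded (range ?\<phi>)"
    unfolding \<phi> by (intro boundedI[of _ 1]) auto
  ultimately show ?thesis
    using u unfolding has_spectral_integral_def by blast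
qed

theorem mainTheorem10:
  fixes a b :: real
  assumes "0 \<le> a" and "a < b"
  shows "(\<forall>E\<in>sets borel. \<forall>f\<in>L2 (phase_space a b).
            L2_has_sum (phase_space a b) (spectral_term E f) (- {0}) (spectral_proj a b E f)) \<and>
         (\<forall>f\<in>L2 (phase_space a b). AE x in phase_space a b. has_time_average f x (fstar f x)) \<and>
         projection_valued_measure (phase_space a b) (zero_mean a b) (spectral_proj a b) \<and>
         (\<forall>f\<in>zero_mean a b. \<forall>g\<in>zero_mean a b.
            complex_measure lborel (\<lambda>E. L2_inner (phase_space a b) g (spectral_proj a b E f)) \<and>
            complex_absolutely_continuous lborel
              (\<lambda>E. L2_inner (phase_space a b) g (spectral_proj a b E f))) \<and>
         (\<forall>f\<in>L2 (phase_space a b). \<forall>t::real. \<exists>u.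
            has_spectral_integral (phase_space a b) (spectral_proj a b)
              (\<lambda>\<beta>. exp (\<i> * of_real \<beta> * of_real t)) f u \<and>
            (AE x in phase_space a b. koopman t f x = fstar f x + u x))"
proof (intro conjI ballI allI)
  fix f assume f: "f \<in> L2 (phase_space a b)"
  show "L2_has_sum (phase_space a b) (spectral_term E f) (- {0}) (spectral_proj a b E f)"
    if "E \<in> sets borel" for E
    using that f by (rule spectral_proj_L2_has_sum)
  show "AE x in phase_space a b. has_time_average f x (fstar f x)"
    using assms(1) f by (rule has_time_average_fstar)
  show "\<exists>u. has_spectral_integral (phase_space a b) (spectral_proj a b)
          (\<lambda>\<beta>. exp (\<i> * of_real \<beta> * of_real t)) f u \<and>
        (AE x in phase_space a b. koopman t f x = fstar f x + u x)" for t
    \<comment> \<open>The witness is the difference of \<open>koopman t f\<close> and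
      \<open>fstar f\<close>, for which the final identity holds at every point.\<close>
    using koopman_has_spectral_integral[OF f, of t] by (intro exI conjI) auto
next
  fix f g assume "f \<in> zero_mean a b" "g \<in> zero_mean a b"
  then have "f \<in> L2 (phase_space a b)" "g \<in> L2 (phase_space a b)"
    by (simp_all add: zero_mean_def)
  then show "complex_measure lborel (\<lambda>E. L2_inner (phase_space a b) g (spectral_proj a b E f))"
    and "complex_absolutely_continuous lborel (\<lambda>E. L2_inner (phase_space a b) g (spectral_proj a b E f))"
    by (simp_all add: spectral_measure_complex_measure spectral_measure_absolutely_continuous)
qed (rule spectral_proj_projection_valued_measure)

end
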